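(* Let $(A,M,\{P_x\}_{x\in X})$ be a matching relative Rota-Baxter algebra. Then the pair $\{C^\bullet_{\mathrm{mrRBA}}(A,M,\{P_x\}_{x\in X}),\delta_{\mathrm{mrRBA}}\}$ is a cochain complex, i.e. $(\delta_{\mathrm{mrRBA}})^2=0$.
   Context: $\mathbb K$ is a commutative unital ring with $\mathrm{char}\,\mathbb K\neq 2$; all modules, linear maps, Hom spaces and tensor products are over $\mathbb K$; $X$ is a nonempty set. $\mu(a,b)=a\cdot b$ denotes the product of $A$, and $l_M(a,u)=a\cdot_M u$, $r_M(u,a)=u\cdot_M a$ the left and right actions on the $A$-bimodule $M$. A matching relative Rota-Baxter algebra is a triple $(A,M,\{P_x\}_{x\in X})$ of an associative algebra $A$, an $A$-bimodule $M$ and linear maps $P_x:M\to A$ such that $P_x(u)\cdot P_y(v)=P_x(u\cdot_M P_y(v))+P_y(P_x(u)\cdot_M v)$ for all $u,v\in M$, $x,y\in X$. $\mathcal A^{n-1,1}$ is the direct sum of all $n$-fold tensor products of $A$ and $M$ in which $A$ appears $n-1$ times and $M$ exactly once. $C^n_{\{P_x\}}(M,A)$ is, for $n\ge1$, the $\mathbb K$-module of all families $f=\oplus f_{x_1,\dots,x_n}$, $f_{x_1,\dots,x_n}\in\mathrm{Hom}(M^{\otimes n},A)$, indexed by $X^{\times n}$ (and $C^0_{\{P_x\}}(M,A)=A$). The map $\delta_{\{P_x\}}:C^n_{\{P_x\}}(M,A)\to C^{n+1}_{\{P_x\}}(M,A)$ is $$(\delta_{\{P_x\}}f)_{x_1,\dots,x_{n+1}}(u_1,\dots,u_{n+1})=P_{x_1}(u_1)\cdot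 f_{x_2,\dots,x_{n+1}}(u_2,\dots,u_{n+1})-P_{x_1}(u_1\cdot_M f_{x_2,\dots,x_{n+1}}(u_2,\dots,u_{n+1}))$$ $$+\sum_{i=1}^n(-1)^i f_{x_1,\dots,x_i,x_{i+2},\dots,x_{n+1}}(u_1,\dots,u_{i-1},u_i\cdot_M P_{x_{i+1}}(u_{i+1}),\dots,u_{n+1})$$ $$+\sum_{i=1}^n(-1)^i f_{x_1,\dots,x_{i-1},x_{i+1},\dots,x_{n+1}}(u_1,\dots,u_{i-1},P_{x_i}(u_i)\cdot_M u_{i+1},\dots,u_{n+1})$$ $$+(-1)^{n+1}f_{x_1,\dots,x_n}(u_1,\dots,u_n)\cdot P_{x_{n+1}}(u_{n+1})-(-1)^{n+1}P_{x_{n+1}}(f_{x_1,\dots,x_n}(u_1,\dots,u_n)\cdot_M u_{n+1}).$$ Cochain modules: $C^0_{\mathrm{mrRBA}}=0$, $C^1_{\mathrm{mrRBA}}=\mathrm{Hom}(A,A)\oplus\mathrm{Hom}(M,M)$, and for $n\ge2$, $C^n_{\mathrm{mrRBA}}=\mathrm{Hom}(A^{\otimes n},A)\oplus\mathrm{Hom}(\mathcal A^{n-1,1},M)\oplus C^{n-1}_{\{P_x\}}(M,A)$. $\delta_{\mathrm{Hoch}}$ is the Hochschild coboundary of $A$ with coefficients in $A$: $\delta_{\mathrm{Hoch}}(f)(a_1,\dots,a_{n+1})=a_1\cdot f(a_2,\dots,a_{n+1})+\sum_{i=1}^n(-1)^if(a_1,\dots,a_i\cdot a_{i+1},\dots,a_{n+1})+(-1)^{n+1}f(a_1,\dots,a_n)\cdot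 a_{n+1}$. For $\alpha\in\mathrm{Hom}(A^{\otimes n},A)$ and $\beta\in\mathrm{Hom}(\mathcal A^{n-1,1},M)$, $\delta^\alpha_{\mathrm{Hoch}}(\beta)\in\mathrm{Hom}(\mathcal A^{n,1},M)$ is $$\delta^\alpha_{\mathrm{Hoch}}(\beta)(a_1,\dots,a_{n+1})=(l_M+r_M)(a_1,(\alpha+\beta)(a_2,\dots,a_{n+1}))+\sum_{i=1}^n(-1)^i\beta(a_1,\dots,(\mu+l_M+r_M)(a_i,a_{i+1}),\dots,a_{n+1})+(-1)^{n+1}(l_M+r_M)((\alpha+\beta)(a_1,\dots,a_n),a_{n+1}),$$ where exactly one $a_j$ lies in $M$ and the others in $A$, and in each sum of maps one applies the unique summand whose domain matches the arguments ($\alpha$ if all its arguments lie in $A$, $\beta$ if exactly one lies in $M$; similarly $\mu,l_M,r_M$). $h_{\{P_x\}}:\mathrm{Hom}(A^{\otimes n},A)\oplus\mathrm{Hom}(\mathcal A^{n-1,1},M)\to C^n_{\{P_x\}}(M,A)$ is $$(h_{\{P_x\}}(\alpha,\beta))_{x_1,\dots,x_n}(u_1,\dots,u_n)=(-1)^n\Big\{\alpha(P_{x_1}(u_1),\dots,P_{x_n}(u_n))-\sum_{i=1}^nP_{x_i}\beta(P_{x_1}(u_1),\dots,u_i,\dots,P_{x_n}(u_n))\Big\}.$$ Finally $\delta_{\mathrm{mrRBA}}:C^n_{\mathrm{mrRBA}}\to C^{n+1}_{\mathrm{mrRBA}}$ is $\delta_{\mathrm{mrRBA}}(\alpha,\beta)=(\delta_{\mathrm{Hoch}}(\alpha),\delta^\alpha_{\mathrm{Hoch}}(\beta),h_{\{P_x\}}(\alpha,\beta))$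 for $n=1$ and $\delta_{\mathrm{mrRBA}}(\alpha,\beta,\gamma)=(\delta_{\mathrm{Hoch}}(\alpha),\delta^\alpha_{\mathrm{Hoch}}(\beta),\delta_{\{P_x\}}(\gamma)+h_{\{P_x\}}(\alpha,\beta))$ for $n\ge 2$ (and zero for $n=0$). *)

theory Defs
  imports
    Complex_Main
    "HOL-Library.Function_Algebras"
    "HOL-Library.Product_Plus"
begin

text \<open>
  All modules live on whole types and carry an explicit scalar multiplication over the ground ring
  (\<^locale>\<open>module\<close>, \<^locale>\<open>module_hom\<close>). Algebras are not assumed to be unital.
\<close>

locale assoc_algebra = module scaleA
  for scaleA :: "'k::comm_ring_1 \<Rightarrow> 'a::ring \<Rightarrow> 'a" +
  assumes scale_mult_left: "scaleA c a * b = scaleA c (a * b)"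
    and scale_mult_right: "a * scaleA c b = scaleA c (a * b)"

locale alg_bimodule = A: assoc_algebra scaleA + M: module scaleM
  for scaleA :: "'k::comm_ring_1 \<Rightarrow> 'a::ring \<Rightarrow> 'a"
    and scaleM :: "'k \<Rightarrow> 'm::ab_group_add \<Rightarrow> 'm" +
  fixes l :: "'a \<Rightarrow> 'm \<Rightarrow> 'm" and r :: "'m \<Rightarrow> 'a \<Rightarrow> 'm"
  assumes l_hom_A: "module_hom scaleA scaleM (\<lambda>a. l a u)"
    and l_hom_M: "module_hom scaleM scaleM (\<lambda>u. l a u)"
    and r_hom_M: "module_hom scaleM scaleM (\<lambda>u. r u a)"
    and r_hom_A: "module_hom scaleA scaleM (\<lambda>a. r u a)"
    and l_assoc: "l (a * b) u = l a (l b u)"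
    and r_assoc: "r u (a * b) = r (r u a) b"
    and lr_assoc: "r (l a u) b = l a (r u b)"

text \<open>The index set is the (automatically nonempty) type \<open>'x\<close>.\<close>

locale matching_rel_RB_algebra = alg_bimodule scaleA scaleM l r
  for scaleA :: "'k::comm_ring_1 \<Rightarrow> 'a::ring \<Rightarrow> 'a"
    and scaleM :: "'k \<Rightarrow> 'm::ab_group_add \<Rightarrow> 'm"
    and l :: "'a \<Rightarrow> 'm \<Rightarrow> 'm" and r :: "'m \<Rightarrow> 'a \<Rightarrow> 'm" +
  fixes P :: "'x \<Rightarrow> 'm \<Rightarrow> 'a"
  assumes P_hom: "module_hom scaleM scaleA (P x)"
    and P_matching: "P x u * P y v = P x (r u (P y v)) + P y (l (P x u) v)"

locale cochain_complex = module scale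
  for scale :: "'k::comm_ring_1 \<Rightarrow> 'c::ab_group_add \<Rightarrow> 'c" +
  fixes C :: "nat \<Rightarrow> 'c set" and d :: "nat \<Rightarrow> 'c \<Rightarrow> 'c"
  assumes C_subspace: "subspace (C n)"
    and d_closed: "f \<in> C n \<Longrightarrow> d n f \<in> C (Suc n)"
    and d_add: "f \<in> C n \<Longrightarrow> g \<in> C n \<Longrightarrow> d n (f + g) = d n f + d n g"
    and d_scale: "f \<in> C n \<Longrightarrow> d n (scale c f) = scale c (d n f)"
    and d_d_eq_0: "f \<in> C n \<Longrightarrow> d (Suc n) (d n f) = 0"

subsection \<open>Multilinear maps\<close>

text \<open>
  By the universal property of the tensor product, a linear map out of an \<open>n\<close>-fold tensor product
  is given by its values on pure tensors, i.e.\ by an \<open>n\<close>-linear map; the arguments are collected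
  in a list. Values on lists that are not argument lists are normalised to \<open>0\<close>, so that
  cochains are equal iff they are equal as functions and the cochain modules are submodules of
  function spaces.
\<close>

definition Hom_tensor ::
  "('k::comm_ring_1 \<Rightarrow> 'b::ab_group_add \<Rightarrow> 'b) \<Rightarrow> ('k \<Rightarrow> 'c::ab_group_add \<Rightarrow> 'c) \<Rightarrow> nat
    \<Rightarrow> ('b list \<Rightarrow> 'c) set" where
  "Hom_tensor s t n =
     {f. (\<forall>as i. length as = n \<longrightarrow> i < n \<longrightarrow> module_hom s t (\<lambda>a. f (as[i := a]))) \<and>
         (\<forall>as. length as \<noteq> n \<longrightarrow> f as = 0)}"

text \<open>
  The pure tensors of $\mathcal A^{n-1,1}$: words of length \<open>n\<close> over \<open>A + M\<close> with exactly one
  letter in \<open>M\<close>; the position of that letter selects the direct summand.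
\<close>

definition mixed_word :: "nat \<Rightarrow> ('a + 'm) list \<Rightarrow> bool" where
  "mixed_word n w \<longleftrightarrow> length w = n \<and> (\<exists>!i. i < n \<and> \<not> isl (w ! i))"

definition Hom_mixed ::
  "('k::comm_ring_1 \<Rightarrow> 'a::ab_group_add \<Rightarrow> 'a) \<Rightarrow> ('k \<Rightarrow> 'm::ab_group_add \<Rightarrow> 'm) \<Rightarrow> nat
    \<Rightarrow> (('a + 'm) list \<Rightarrow> 'm) set" where
  "Hom_mixed sA sM n =
     {g. (\<forall>w i. mixed_word n w \<longrightarrow> i < n \<longrightarrow>
            (if isl (w ! i) then module_hom sA sM (\<lambda>a. g (w[i := Inl a]))
             else module_hom sM sM (\<lambda>u. g (w[i := Inr u])))) \<and>
         (\<forall>w. \<not> mixed_word n w \<longrightarrow> g w = 0)}"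

text \<open>
  $C^n_{\{P_x\}}(M,A)$: the first argument is the multi-index $(x_1,\dots,x_n)$. For \<open>n = 0\<close> this is
  a copy of \<open>A\<close>.
\<close>

definition RB_cochains ::
  "('k::comm_ring_1 \<Rightarrow> 'a::ab_group_add \<Rightarrow> 'a) \<Rightarrow> ('k \<Rightarrow> 'm::ab_group_add \<Rightarrow> 'm) \<Rightarrow> nat
    \<Rightarrow> ('x list \<Rightarrow> 'm list \<Rightarrow> 'a) set" where
  "RB_cochains sA sM n =
     {f. (\<forall>xs. length xs = n \<longrightarrow> f xs \<in> Hom_tensor sM sA n) \<and>
         (\<forall>xs. length xs \<noteq> n \<longrightarrow> f xs = 0)}"

subsection \<open>Coboundary maps\<close>

text \<open>
  $(-1)^n x$. In the definitions below, indices \<open>i\<close> of summations start at \<open>1\<close> as on paper, so that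
  the \<open>i\<close>-th entry of a list is \<open>as ! (i - 1)\<close> and the \<open>(i+1)\<close>-st is \<open>as ! i\<close>.
\<close>

definition alt_sign :: "nat \<Rightarrow> 'b::ab_group_add \<Rightarrow> 'b" where
  "alt_sign n x = (if even n then x else - x)"

definition delta_Hoch :: "nat \<Rightarrow> ('a::ring list \<Rightarrow> 'a) \<Rightarrow> 'a list \<Rightarrow> 'a" where
  "delta_Hoch n f as =
     (if length as = Suc n then
        hd as * f (tl as)
        + (\<Sum>i = 1..n. alt_sign i (f (take (i - 1) as @ [as ! (i - 1) * as ! i] @ drop (i + 1) as)))
        + alt_sign (n + 1) (f (butlast as) * last as)
      else 0)"

text \<open>
  $l_M + r_M$ and $\mu + l_M + r_M$ on letters. The remaining argument combinations do not occur
  on mixed words and are sent to \<open>0\<close>.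
\<close>

fun lr_sum :: "('a \<Rightarrow> 'm::zero \<Rightarrow> 'm) \<Rightarrow> ('m \<Rightarrow> 'a \<Rightarrow> 'm) \<Rightarrow> 'a + 'm \<Rightarrow> 'a + 'm \<Rightarrow> 'm" where
  "lr_sum l r (Inl a) (Inr u) = l a u"
| "lr_sum l r (Inr u) (Inl a) = r u a"
| "lr_sum l r _ _ = 0"

fun mu_lr_sum ::
  "('a::times \<Rightarrow> 'm::zero \<Rightarrow> 'm) \<Rightarrow> ('m \<Rightarrow> 'a \<Rightarrow> 'm) \<Rightarrow> 'a + 'm \<Rightarrow> 'a + 'm \<Rightarrow> 'a + 'm" where
  "mu_lr_sum l r (Inl a) (Inl b) = Inl (a * b)"
| "mu_lr_sum l r y z = Inr (lr_sum l r y z)"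

text \<open>$\alpha + \beta$ on words with at most one letter in \<open>M\<close>.\<close>

definition alpha_beta_sum ::
  "('a list \<Rightarrow> 'a) \<Rightarrow> (('a + 'm) list \<Rightarrow> 'm) \<Rightarrow> ('a + 'm) list \<Rightarrow> 'a + 'm" where
  "alpha_beta_sum \<alpha> \<beta> w = (if list_all isl w then Inl (\<alpha> (map projl w)) else Inr (\<beta> w))"

definition delta_Hoch_mixed ::
  "('a::ring \<Rightarrow> 'm::ab_group_add \<Rightarrow> 'm) \<Rightarrow> ('m \<Rightarrow> 'a \<Rightarrow> 'm) \<Rightarrow> nat
    \<Rightarrow> ('a list \<Rightarrow> 'a) \<Rightarrow> (('a + 'm) list \<Rightarrow> 'm) \<Rightarrow> ('a + 'm) list \<Rightarrow> 'm" where
  "delta_Hoch_mixed l r n \<alpha> \<beta> w =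
     (if mixed_word (Suc n) w then
        lr_sum l r (hd w) (alpha_beta_sum \<alpha> \<beta> (tl w))
        + (\<Sum>i = 1..n. alt_sign i
             (\<beta> (take (i - 1) w @ [mu_lr_sum l r (w ! (i - 1)) (w ! i)] @ drop (i + 1) w)))
        + alt_sign (n + 1) (lr_sum l r (alpha_beta_sum \<alpha> \<beta> (butlast w)) (last w))
      else 0)"

definition delta_RB ::
  "('a::ring \<Rightarrow> 'm::ab_group_add \<Rightarrow> 'm) \<Rightarrow> ('m \<Rightarrow> 'a \<Rightarrow> 'm) \<Rightarrow> ('x \<Rightarrow> 'm \<Rightarrow> 'a) \<Rightarrow> nat
    \<Rightarrow> ('x list \<Rightarrow> 'm list \<Rightarrow> 'a) \<Rightarrow> 'x list \<Rightarrow> 'm list \<Rightarrow> 'a" where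
  "delta_RB l r P n f xs us =
     (if length xs = Suc n \<and> length us = Suc n then
        P (hd xs) (hd us) * f (tl xs) (tl us)
        - P (hd xs) (r (hd us) (f (tl xs) (tl us)))
        + (\<Sum>i = 1..n. alt_sign i
             (f (take i xs @ drop (i + 1) xs)
                (take (i - 1) us @ [r (us ! (i - 1)) (P (xs ! i) (us ! i))] @ drop (i + 1) us)))
        + (\<Sum>i = 1..n. alt_sign i
             (f (take (i - 1) xs @ drop i xs)
                (take (i - 1) us @ [l (P (xs ! (i - 1)) (us ! (i - 1))) (us ! i)] @ drop (i + 1) us)))
        + alt_sign (n + 1) (f (butlast xs) (butlast us) * P (last xs) (last us))
        - alt_sign (n + 1) (P (last xs) (l (f (butlast xs) (butlast us)) (last us)))
      else 0)"

definition h_RB ::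
  "('x \<Rightarrow> 'm \<Rightarrow> 'a::ab_group_add) \<Rightarrow> nat \<Rightarrow> ('a list \<Rightarrow> 'a) \<Rightarrow> (('a + 'm) list \<Rightarrow> 'm)
    \<Rightarrow> 'x list \<Rightarrow> 'm list \<Rightarrow> 'a" where
  "h_RB P n \<alpha> \<beta> xs us =
     (if length xs = n \<and> length us = n then
        alt_sign n
          (\<alpha> (map2 P xs us)
           - (\<Sum>i = 1..n. P (xs ! (i - 1))
                (\<beta> ((map Inl (map2 P xs us))[i - 1 := Inr (us ! (i - 1))]))))
      else 0)"

subsection \<open>The complex of a matching relative Rota-Baxter algebra\<close>

type_synonym ('a, 'm, 'x) mrRBA_cochain =
  "('a list \<Rightarrow> 'a) \<times> (('a + 'm) list \<Rightarrow> 'm) \<times> ('x list \<Rightarrow> 'm list \<Rightarrow> 'a)"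

definition mrRBA_scale ::
  "('k \<Rightarrow> 'a \<Rightarrow> 'a) \<Rightarrow> ('k \<Rightarrow> 'm \<Rightarrow> 'm) \<Rightarrow> 'k
    \<Rightarrow> ('a, 'm, 'x) mrRBA_cochain \<Rightarrow> ('a, 'm, 'x) mrRBA_cochain" where
  "mrRBA_scale sA sM c =
     (\<lambda>(\<alpha>, \<beta>, \<gamma>). (\<lambda>as. sA c (\<alpha> as), \<lambda>w. sM c (\<beta> w), \<lambda>xs us. sA c (\<gamma> xs us)))"

text \<open>
  Cochains of degree \<open>0\<close> and \<open>1\<close> are padded with zero components. Note
  $\mathrm{Hom}(\mathcal A^{0,1},M) = \mathrm{Hom}(M,M)$, and that in degree \<open>1\<close> the third
  component is \<open>0\<close> rather than $C^0_{\{P_x\}}(M,A) = A$.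
\<close>

definition mrRBA_cochains ::
  "('k::comm_ring_1 \<Rightarrow> 'a::ab_group_add \<Rightarrow> 'a) \<Rightarrow> ('k \<Rightarrow> 'm::ab_group_add \<Rightarrow> 'm) \<Rightarrow> nat
    \<Rightarrow> ('a, 'm, 'x) mrRBA_cochain set" where
  "mrRBA_cochains sA sM n =
     (if n = 0 then {0}
      else if n = 1 then Hom_tensor sA sA 1 \<times> Hom_mixed sA sM 1 \<times> {0}
      else Hom_tensor sA sA n \<times> Hom_mixed sA sM n \<times> RB_cochains sA sM (n - 1))"

definition delta_mrRBA ::
  "('a::ring \<Rightarrow> 'm::ab_group_add \<Rightarrow> 'm) \<Rightarrow> ('m \<Rightarrow> 'a \<Rightarrow> 'm) \<Rightarrow> ('x \<Rightarrow> 'm \<Rightarrow> 'a) \<Rightarrow> nat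
    \<Rightarrow> ('a, 'm, 'x) mrRBA_cochain \<Rightarrow> ('a, 'm, 'x) mrRBA_cochain" where
  "delta_mrRBA l r P n =
     (\<lambda>(\<alpha>, \<beta>, \<gamma>).
        if n = 0 then 0
        else if n = 1 then (delta_Hoch 1 \<alpha>, delta_Hoch_mixed l r 1 \<alpha> \<beta>, h_RB P 1 \<alpha> \<beta>)
        else (delta_Hoch n \<alpha>, delta_Hoch_mixed l r n \<alpha> \<beta>,
              delta_RB l r P (n - 1) \<gamma> + h_RB P n \<alpha> \<beta>))"

end

theory Submission
  imports Defs
begin

text \<open>
  All three coboundaries are Hochschild coboundaries, and the map \<open>h\<close> is, up to sign, a morphism
  between two of these Hochschild complexes.

  On the one hand, the semidirect product of \<open>A\<close> and \<open>M\<close> (where \<open>M\<close> squares to zero) acts on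
  itself from both sides, and a pair \<open>(\<alpha>, \<beta>)\<close> is a cochain of this algebra with coefficients in
  itself whose values have weight equal to the number of arguments from \<open>M\<close>. Its Hochschild coboundary
  is the pair \<open>(\<delta> \<alpha>, \<delta>\<^sup>\<alpha> \<beta>)\<close>.

  On the other hand, the direct sum of copies of \<open>M\<close> indexed by \<open>X\<close> is an associative algebra under
  \<open>(x, u) (y, v) = (x, u P\<^sub>y v) + (y, (P\<^sub>x u) v)\<close>, the matching identity says that \<open>(x, u) \<mapsto> P\<^sub>x u\<close> is
  multiplicative, and \<open>A\<close> is a bimodule over this algebra by \<open>(x, u) a = P\<^sub>x u a - P\<^sub>x (u a)\<close> and
  \<open>a (x, u) = a P\<^sub>x u - P\<^sub>x (a u)\<close>. Families indexed by words over \<open>X\<close> are the multilinear cochains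
  of this algebra, and the coboundary of such families is the Hochschild coboundary.

  Finally let \<open>\<Phi> (\<alpha>, \<beta>)\<close> be the sum in the definition of \<open>h\<close> without the sign \<open>(-1)\<^sup>n\<close>. It
  commutes with each face separately: with the outer faces by the matching identity applied to
  \<open>P\<^sub>x u\<close> and \<open>P\<^sub>y (\<beta> (\<dots>))\<close>, with the inner ones because the insertion of \<open>P\<close> is multiplicative.
  Hence \<open>\<Phi>\<close> commutes with the coboundaries, the signs \<open>(-1)\<^sup>n\<close> and \<open>(-1)\<close> to the power \<open>n + 1\<close> turn
  this into \<open>\<delta> h + h \<delta> = 0\<close>, and the square of the total differential vanishes.

  To treat both algebras at once without forming tensor products, free modules or direct sums, the
  Hochschild complex is developed for words over a set of letters, where a product of two letters is
  a finite family of letters (thought of as their sum). Linear structure on letters enters only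
  through a relation \<open>lin c a b e\<close>, read \<open>e = c a + b\<close>, which may hold for few triples. The
  identities between the faces (lemma \<open>face_face\<close>) give that the square of the coboundary is zero;
  lemmas \<open>coboundary_joint\<close> and \<open>coboundary_family\<close> identify the coboundaries of the problem, and
  lemma \<open>pullback_face\<close> is the compatibility of \<open>\<Phi>\<close> with the faces.
\<close>

section \<open>Signs\<close>

lemma alt_sign_zero [simp]: "alt_sign n 0 = 0"
  and alt_sign_add: "alt_sign n (x + y) = alt_sign n x + alt_sign n y"
  and alt_sign_diff: "alt_sign n (x - y) = alt_sign n x - alt_sign n y"
  and alt_sign_Suc: "alt_sign (Suc n) x = - alt_sign n x"
  and alt_sign_alt_sign: "alt_sign m (alt_sign n x) = alt_sign (m + n) x"
  and alt_sign_0 [simp]: "alt_sign 0 x = x"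
  by (auto simp: alt_sign_def)

lemma alt_sign_sum: "alt_sign n (sum f A) = (\<Sum>i\<in>A. alt_sign n (f i))"
  by (simp add: alt_sign_def sum_negf)

lemma additive_alt_sign:
  fixes g :: "'a::ab_group_add \<Rightarrow> 'b::ab_group_add"
  assumes "\<And>x y. g (x + y) = g x + g y"
  shows "g (alt_sign n x) = alt_sign n (g x)"
proof -
  interpret additive g using assms by unfold_locales
  show ?thesis by (simp add: alt_sign_def minus)
qed

text \<open>
  The cosimplicial sign cancellation: the hypothesis pairs the term at \<open>(j, i)\<close> with \<open>i < j\<close> with the
  one at \<open>(i, j - 1)\<close>, which has the opposite sign.
\<close>

lemma alternating_double_sum_eq_0:
  fixes F :: "nat \<Rightarrow> nat \<Rightarrow> 'n::ab_group_add"
  assumes "\<And>i j. i < j \<Longrightarrow> j \<le> Suc n \<Longrightarrow> F j i = F i (j - 1)"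
  shows "(\<Sum>j\<le>Suc n. \<Sum>i\<le>n. alt_sign (j + i) (F j i)) = 0"
proof -
  let ?g = "\<lambda>(j, i). alt_sign (j + i) (F j i)"
  let ?A = "{(j, i). j \<le> Suc n \<and> i < j}" and ?B = "{(j, i). i \<le> n \<and> j \<le> i}"
  have fin: "finite ?A" "finite ?B"
    by (rule finite_subset[of _ "{..Suc n} \<times> {..Suc n}"]; auto)+
  have sgn: "alt_sign (a + b - Suc 0) y = - alt_sign (a + b) y" if "b < a" for a b and y :: 'n
    using that by (cases a) (auto simp: alt_sign_Suc)
  have "{..Suc n} \<times> {..n} = ?A \<union> ?B" by auto
  then have "(\<Sum>j\<le>Suc n. \<Sum>i\<le>n. alt_sign (j + i) (F j i)) = sum ?g (?A \<union> ?B)"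
    by (simp add: sum.cartesian_product del: sum.atMost_Suc)
  also have "\<dots> = sum ?g ?A + sum ?g ?B"
    by (rule sum.union_disjoint) (use fin in auto)
  also have "sum ?g ?A = (\<Sum>x\<in>?B. - ?g x)"
    by (rule sum.reindex_bij_witness[of _ "\<lambda>(j, i). (Suc i, j)" "\<lambda>(j, i). (i, j - 1)"])
      (auto simp: assms sgn add.commute)
  finally show ?thesis by (simp add: sum_negf)
qed

section \<open>Contracting neighbouring letters of a word\<close>

text \<open>
  \<open>contract m k\<close> multiplies the letters at the positions \<open>k\<close> and \<open>k + 1\<close>, counted from \<open>0\<close>. The recursion
  makes the commutation of two contractions provable by induction.
\<close>

fun contract :: "('b \<Rightarrow> 'b \<Rightarrow> 'b) \<Rightarrow> nat \<Rightarrow> 'b list \<Rightarrow> 'b list" where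
  "contract m 0 (a # b # w) = m a b # w"
| "contract m (Suc k) (a # w) = a # contract m k w"
| "contract m _ w = w"

lemma length_contract [simp]: "Suc k < length w \<Longrightarrow> length (contract m k w) = length w - 1"
  by (induction m k w rule: contract.induct) auto

lemma contract_conv_take_drop:
  "Suc k < length w \<Longrightarrow> contract m k w = take k w @ [m (w ! k) (w ! Suc k)] @ drop (Suc (Suc k)) w"
  by (induction m k w rule: contract.induct) auto

lemma contract_append_right: "contract m (length p + k) (p @ w) = p @ contract m k w"
  by (induction p) auto

lemma contract_at: "contract m (length p) (p @ a # b # w) = p @ m a b # w"
  using contract_append_right[of m p 0] by simp

lemma contract_append_left: "Suc k < length p \<Longrightarrow> contract m k (p @ w) = contract m k p @ w"
  by (induction m k p rule: contract.induct) auto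

lemma contract_commute:
  "i < j \<Longrightarrow> contract m i (contract m' (Suc j) w) = contract m' j (contract m i w)"
proof (induction m i w arbitrary: j rule: contract.induct)
  case (1 m a b w)
  then show ?case by (cases j) auto
next
  case (2 m k a w)
  then show ?case by (cases j) auto
next
  case ("3_1" m)
  then show ?case by simp
next
  case ("3_2" m v)
  then show ?case by (cases j) auto
next
  case ("3_3" m)
  then show ?case by (cases j) auto
qed

section \<open>The Hochschild complex of words\<close>

text \<open>
  Here \<open>lin c a b e\<close> is read as \<open>e = c a + b\<close>. A relation in place of operations on letters allows
  letters of different kinds, of which only those of the same kind can be added.
\<close>

definition multilinear_word ::
  "('k \<Rightarrow> 'b \<Rightarrow> 'b \<Rightarrow> 'b \<Rightarrow> bool) \<Rightarrow> ('k \<Rightarrow> 'n::plus \<Rightarrow> 'n) \<Rightarrow> nat \<Rightarrow> ('b list \<Rightarrow> 'n) \<Rightarrow> bool" where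
  "multilinear_word lin t n f \<longleftrightarrow>
     (\<forall>p q c a b e. Suc (length p + length q) = n \<longrightarrow> lin c a b e \<longrightarrow>
        f (p @ e # q) = t c (f (p @ a # q)) + f (p @ b # q))"

lemma multilinear_wordD:
  "multilinear_word lin t n f \<Longrightarrow> lin c a b e \<Longrightarrow> Suc (length p + length q) = n \<Longrightarrow>
    f (p @ e # q) = t c (f (p @ a # q)) + f (p @ b # q)"
  unfolding multilinear_word_def by blast

lemma (in module) multilinear_word_comb:
  assumes "multilinear_word lin scale n F" and "multilinear_word lin scale n G"
  shows "multilinear_word lin scale n (\<lambda>w. scale c (F w) + G w)"
  using assms unfolding multilinear_word_def
  by (auto simp: scale_right_distrib mult.commute add_ac)

text \<open>
  An associative algebra spanned by the letters together with a bimodule, where the product of the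
  letters \<open>a\<close> and \<open>b\<close> is the formal sum over \<open>j\<close> of the letters \<open>m j a b\<close>. Such a sum has a meaning only
  under a map \<open>F\<close> into a module, and associativity of \<open>m\<close> in the usual sense would be too much: in
  the applications some of the summands agree only after adding letters, so the law is required
  for linear \<open>F\<close>.
\<close>

locale hochschild_data = module t
  for t :: "'k::comm_ring_1 \<Rightarrow> 'n::ab_group_add \<Rightarrow> 'n" +
  fixes lin :: "'k \<Rightarrow> 'b \<Rightarrow> 'b \<Rightarrow> 'b \<Rightarrow> bool"
    and m :: "'j::finite \<Rightarrow> 'b \<Rightarrow> 'b \<Rightarrow> 'b"
    and L :: "'b \<Rightarrow> 'n \<Rightarrow> 'n" and R :: "'n \<Rightarrow> 'b \<Rightarrow> 'n"
  assumes m_lin_left: "lin c a b e \<Longrightarrow> lin c (m j a z) (m j b z) (m j e z)"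
    and m_lin_right: "lin c a b e \<Longrightarrow> lin c (m j z a) (m j z b) (m j z e)"
    and L_lin: "lin c a b e \<Longrightarrow> L e y = t c (L a y) + L b y"
    and R_lin: "lin c a b e \<Longrightarrow> R y e = t c (R y a) + R y b"
    and L_comb: "L a (t c y + y') = t c (L a y) + L a y'"
    and R_comb: "R (t c y + y') a = t c (R y a) + R y' a"
    and L_m: "(\<Sum>j\<in>UNIV. L (m j a b) y) = L a (L b y)"
    and R_m: "(\<Sum>j\<in>UNIV. R y (m j a b)) = R (R y a) b"
    and LR: "R (L a y) b = L a (R y b)"
    and m_assoc: "(\<And>c a b e. lin c a b e \<Longrightarrow> F e = t c (F a) + F b) \<Longrightarrow>
      (\<Sum>i\<in>UNIV. \<Sum>j\<in>UNIV. F (m j (m i a b) z)) = (\<Sum>i\<in>UNIV. \<Sum>j\<in>UNIV. (F (m j a (m i b z)) :: 'n))"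
begin

lemma L_add: "L a (y + y') = L a y + L a y'" using L_comb[of a 1 y y'] by simp
lemma R_add: "R (y + y') a = R y a + R y' a" using R_comb[of 1 y y' a] by simp
lemma L_zero [simp]: "L a 0 = 0" using L_add[of a 0 0] by simp
lemma R_zero [simp]: "R 0 a = 0" using R_add[of 0 0 a] by simp

text \<open>
  The face \<open>i\<close> of a cochain of degree \<open>n\<close>, with \<open>0 \<le> i \<le> n + 1\<close>; the face \<open>i\<close> with \<open>1 \<le> i \<le> n\<close> contracts
  at the position \<open>i - 1\<close>.
\<close>

definition face :: "nat \<Rightarrow> nat \<Rightarrow> ('b list \<Rightarrow> 'n) \<Rightarrow> 'b list \<Rightarrow> 'n" where
  "face n i f w =
     (if i = 0 then L (hd w) (f (tl w))
      else if i \<le> n then \<Sum>j\<in>UNIV. f (contract (m j) (i - 1) w)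
      else R (f (butlast w)) (last w))"

definition coboundary :: "nat \<Rightarrow> ('b list \<Rightarrow> 'n) \<Rightarrow> 'b list \<Rightarrow> 'n" where
  "coboundary n f w = (if length w = Suc n then \<Sum>i\<le>Suc n. alt_sign i (face n i f w) else 0)"

lemma face_cong:
  assumes "length w = Suc n" and "i \<le> Suc n"
    and "\<And>v. length v = n \<Longrightarrow> f v = g v"
  shows "face n i f w = face n i g w"
  using assms by (auto simp: face_def)

lemma face_comb:
  "face n i (\<lambda>v. t c (f v) + g v) w = t c (face n i f w) + face n i g w"
  by (simp add: face_def L_comb R_comb sum.distrib scale_sum_right)

lemma face_alternating_sum:
  assumes "finite I"
  shows "face n i (\<lambda>v. \<Sum>k\<in>I. alt_sign k (f k v)) w = (\<Sum>k\<in>I. alt_sign k (face n i (f k) w))"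
  using assms
proof (induction I rule: finite_induct)
  case empty
  show ?case by (simp add: face_def)
next
  case (insert k I)
  have "face n i (\<lambda>v. alt_sign k (f k v)) w = alt_sign k (face n i (f k) w)"
    by (simp add: face_def additive_alt_sign[of "L _"] additive_alt_sign[of "\<lambda>y. R y _"]
        L_add R_add alt_sign_sum)
  then show ?case
    using insert face_comb[of n i 1 "\<lambda>v. alt_sign k (f k v)"] by simp
qed

lemma coboundary_comb:
  "coboundary n (\<lambda>v. t c (f v) + g v) w = t c (coboundary n f w) + coboundary n g w"
proof -
  have "alt_sign i (t c y) = t c (alt_sign i y)" for i y
    by (simp add: alt_sign_def)
  then show ?thesis
    by (simp add: coboundary_def face_comb alt_sign_add sum.distrib scale_sum_right
        scale_right_distrib del: sum.atMost_Suc)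
qed

lemma coboundary_zero [simp]: "coboundary n (\<lambda>v. 0) w = 0"
  using coboundary_comb[of n 1 "\<lambda>v. 0" "\<lambda>v. 0" w] by simp

lemma coboundary_add: "coboundary n (\<lambda>v. f v + g v) w = coboundary n f w + coboundary n g w"
  using coboundary_comb[of n 1 f g w] by simp

lemma coboundary_alt_sign: "coboundary n (\<lambda>v. alt_sign k (f v)) w = alt_sign k (coboundary n f w)"
  using coboundary_comb[of n "- 1" f "\<lambda>v. 0" w] by (simp add: alt_sign_def)

lemma coboundary_cong:
  assumes "\<And>v. length v = n \<Longrightarrow> f v = g v"
  shows "coboundary n f w = coboundary n g w"
  using face_cong[of w n _ f g] assms by (simp add: coboundary_def del: sum.atMost_Suc)

text \<open>
  The cosimplicial identities. Contractions at distant positions commute, at overlapping positions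
  (\<open>j = i + 1\<close>) the identity is associativity, which holds under multilinear maps, and the cases with an
  outer face and no contraction or an adjacent one are the bimodule laws.
\<close>

lemma face_face:
  assumes f: "multilinear_word lin t n f" and w: "length w = Suc (Suc n)"
    and ij: "i < j" "j \<le> Suc (Suc n)"
  shows "face (Suc n) j (face n i f) w = face (Suc n) i (face n (j - 1) f) w"
proof -
  obtain a b s where ab: "w = a # b # s" "length s = n"
    using w by (auto simp: length_Suc_conv)
  obtain p d e where de: "w = p @ [d, e]" "length p = n"
  proof -
    have "length (drop n w) = Suc (Suc 0)" using w by simp
    then obtain d e where "drop n w = [d, e]" unfolding length_Suc_conv length_0_conv by blast
    then show ?thesis
      using that[of "take n w" d e] w append_take_drop_id[of n w] by simp
  qed
  consider "i = 0" "j = Suc (Suc n)" | "i = 0" "j = 1" | "i = 0" "1 < j" "j \<le> Suc n"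
    | "0 < i" "i \<le> n" "j = Suc (Suc n)" | "i = Suc n" "j = Suc (Suc n)"
    | "0 < i" "Suc i < j" "j \<le> Suc n" | "0 < i" "j = Suc i" "j \<le> Suc n"
    using ij by (cases "i = 0"; cases "j = Suc (Suc n)"; cases "j = Suc i"; cases "i = Suc n") auto
  then show ?thesis
  proof cases
    case 1
    have "hd (butlast w) = hd w" "tl (butlast w) = butlast (tl w)" "last (tl w) = last w"
      using ab by auto
    with 1 show ?thesis by (simp add: face_def LR)
  next
    case 2
    then show ?thesis using ab by (simp add: face_def L_m)
  next
    case 3
    then obtain k where k: "j = Suc (Suc k)" by (cases j; cases "j - 1") auto
    then show ?thesis using 3 ab
      by (simp add: face_def) (subst additive.sum[of "L _"], auto simp: additive_def L_add)
  next
    case 4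
    then obtain k where k: "i = Suc k" by (cases i) auto
    have "contract (m x) k w = contract (m x) k (butlast w) @ [last w]" for x
      using contract_append_left[of k "p @ [d]" "m x" "[e]"] de 4 k by (simp add: butlast_append)
    then show ?thesis using 4 k
      by (simp add: face_def) (subst additive.sum[of "\<lambda>y. R y _"], auto simp: additive_def R_add)
  next
    case 5
    then show ?thesis using de contract_at[of _ p d e "[]"]
      by (simp add: face_def R_m butlast_append)
  next
    case 6
    then obtain k where k: "i = Suc k" by (cases i) auto
    from 6 k obtain h where h: "j = Suc (Suc h)" "k < h" by (cases j; cases "j - 1") auto
    show ?thesis using 6 k h
      by (simp add: face_def contract_commute) (rule sum.swap)
  next
    case 7
    then obtain k where k: "i = Suc k" by (cases i) auto
    let ?p = "take k w" and ?q = "drop (k + 3) w"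
    have lens: "length ?p = k" "Suc (length ?p + length ?q) = n"  using w 7 k by auto
    have "w = ?p @ w ! k # w ! (k+1) # w ! (k+2) # ?q"
      using w 7 k by (simp add: Cons_nth_drop_Suc numeral_3_eq_3)
    then obtain x y z where xyz: "w = ?p @ x # y # z # ?q" by blast
    have c1: "contract (m r) k (contract (m s) (Suc k) w) = ?p @ m r x (m s y z) # ?q" for r s
      using contract_at[of "m s" "?p @ [x]" y z ?q] contract_at[of "m r" ?p x "m s y z" ?q] xyz lens
      by simp
    have c2: "contract (m r) k (contract (m s) k w) = ?p @ m r (m s x y) z # ?q" for r s
      using contract_at[of "m s" "?p" x y "z # ?q"] contract_at[of "m r" ?p "m s x y" z ?q] xyz lens
      by simp
    have "(\<Sum>i\<in>UNIV. \<Sum>j\<in>UNIV. f (?p @ m j (m i x y) z # ?q))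
        = (\<Sum>i\<in>UNIV. \<Sum>j\<in>UNIV. f (?p @ m j x (m i y z) # ?q))"
      by (rule m_assoc) (rule multilinear_wordD[OF f _ lens(2)])
    then show ?thesis using 7 k by (simp add: face_def c1 c2)
  qed
qed

lemma coboundary_coboundary:
  assumes f: "multilinear_word lin t n f"
  shows "coboundary (Suc n) (coboundary n f) w = 0"
proof (cases "length w = Suc (Suc n)")
  case True
  have "face (Suc n) j (coboundary n f) w = (\<Sum>i\<le>Suc n. alt_sign i (face (Suc n) j (face n i f) w))"
    if "j \<le> Suc (Suc n)" for j
    using face_cong[of w "Suc n" j "coboundary n f" "\<lambda>v. \<Sum>i\<le>Suc n. alt_sign i (face n i f v)"]
      True that face_alternating_sum[of "{..Suc n}" "Suc n" j "\<lambda>i. face n i f"]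
    by (simp add: coboundary_def del: sum.atMost_Suc)
  then have "coboundary (Suc n) (coboundary n f) w
      = (\<Sum>j\<le>Suc (Suc n). \<Sum>i\<le>Suc n. alt_sign (j + i) (face (Suc n) j (face n i f) w))"
    using True unfolding coboundary_def[of "Suc n"]
    by (simp add: alt_sign_sum alt_sign_alt_sign del: sum.atMost_Suc)
  also have "\<dots> = 0"
    by (rule alternating_double_sum_eq_0) (rule face_face[OF f True])
  finally show ?thesis .
qed (simp add: coboundary_def)

lemma multilinear_face:
  assumes f: "multilinear_word lin t n f" and i: "i \<le> Suc n"
  shows "multilinear_word lin t (Suc n) (face n i f)"
  unfolding multilinear_word_def
proof (intro allI impI)
  fix p q :: "'b list" and c a b e
  assume len: "Suc (length p + length q) = Suc n" and lin: "lin c a b e"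
  note D = multilinear_wordD[OF f]
  consider "i = 0" | "i = Suc n" | k where "i = Suc k" "Suc k \<le> n"
    using i by (metis le_SucE not0_implies_Suc)
  then show "face n i f (p @ e # q) = t c (face n i f (p @ a # q)) + face n i f (p @ b # q)"
  proof cases
    case 1
    show ?thesis
    proof (cases p)
      case Nil
      with 1 show ?thesis by (simp add: face_def L_lin[OF lin])
    next
      case (Cons x p')
      then show ?thesis using 1 D[OF lin, of p' q] len by (simp add: face_def L_comb)
    qed
  next
    case 2
    show ?thesis
    proof (cases q rule: rev_cases)
      case Nil
      with 2 show ?thesis by (simp add: face_def R_lin[OF lin])
    next
      case (snoc q' x)
      then show ?thesis using 2 D[OF lin, of p q'] len 
        by (simp add: face_def R_comb butlast_append)
    qed
  next
    case (3 k)
    have "f (contract (m j) k (p @ e # q))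
        = t c (f (contract (m j) k (p @ a # q))) + f (contract (m j) k (p @ b # q))" for j
    proof -
      consider "Suc k < length p" | "Suc k = length p" | "k = length p" | "length p < k" by linarith
      then show ?thesis
      proof cases
        case 1
        then show ?thesis using D[OF lin, of "contract (m j) k p" q] len
          by (simp add: contract_append_left)
      next
        case 2
        then obtain p' x where p: "p = p' @ [x]" "length p' = k"
          by (cases p rule: rev_cases) auto
        then show ?thesis 
          using D[OF m_lin_right[OF lin, of j x], of p' q] len by (auto simp: contract_at)
      next
        case 3
        with \<open>Suc k \<le> n\<close> len obtain x q' where "q = x # q'" by (cases q) auto
        then show ?thesis using 3 D[OF m_lin_left[OF lin, of j x], of p q'] len
          by (simp add: contract_at)
      next
        case 4
        then obtain h where h: "k = length p + Suc h" using less_iff_Suc_add by auto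
        then show ?thesis using D[OF lin, of p "contract (m j) h q"] 3 len
          by (simp only: contract_append_right contract.simps) simp
      qed
    qed
    then show ?thesis using 3 by (simp add: face_def sum.distrib scale_sum_right)
  qed
qed

lemma multilinear_coboundary:
  assumes f: "multilinear_word lin t n f"
  shows "multilinear_word lin t (Suc n) (coboundary n f)"
  unfolding multilinear_word_def
proof (intro allI impI)
  fix p q :: "'b list" and c a b e
  assume len: "Suc (length p + length q) = Suc n" and lin: "lin c a b e"
  have "alt_sign i (t c y) = t c (alt_sign i y)" for i y by (simp add: alt_sign_def)
  then have "alt_sign i (face n i f (p @ e # q))
     = t c (alt_sign i (face n i f (p @ a # q))) + alt_sign i (face n i f (p @ b # q))"
    if "i \<in> {..Suc n}" for i
    using multilinear_wordD[OF multilinear_face[OF f] lin len] that by (simp add: alt_sign_add)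
  then have "(\<Sum>i\<le>Suc n. alt_sign i (face n i f (p @ e # q)))
     = (\<Sum>i\<le>Suc n. t c (alt_sign i (face n i f (p @ a # q))) + alt_sign i (face n i f (p @ b # q)))"
    by (rule sum.cong[OF refl])
  then show "coboundary n f (p @ e # q)
     = t c (coboundary n f (p @ a # q)) + coboundary n f (p @ b # q)"
    using len by (simp add: coboundary_def sum.distrib scale_sum_right del: sum.atMost_Suc)
qed

text \<open>
  The coboundary in the form used on paper, with the outer faces split off.
\<close>

lemma coboundary_eq:
  assumes "length w = Suc n"
  shows "coboundary n f w =
      L (hd w) (f (tl w))
      + (\<Sum>i = 1..n. alt_sign i (\<Sum>j\<in>UNIV.
           f (take (i - 1) w @ [m j (w ! (i - 1)) (w ! i)] @ drop (i + 1) w)))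
      + alt_sign (n + 1) (R (f (butlast w)) (last w))"
proof -
  have "{..Suc n} = insert 0 (insert (Suc n) {1..n})" by auto
  then have "coboundary n f w = face n 0 f w + (\<Sum>i = 1..n. alt_sign i (face n i f w))
      + alt_sign (n + 1) (face n (Suc n) f w)"
    using assms by (simp add: coboundary_def add_ac del: sum.atMost_Suc)
  moreover have "face n i f w = (\<Sum>j\<in>UNIV.
      f (take (i - 1) w @ [m j (w ! (i - 1)) (w ! i)] @ drop (i + 1) w))" if "i \<in> {1..n}" for i
    using that assms by (cases i) (auto simp: face_def contract_conv_take_drop)
  ultimately show ?thesis by (simp add: face_def)
qed

end


section \<open>Cochains as multilinear functions of words\<close>

lemma module_hom_iff_comb:
  assumes "module s" and "module t"
  shows "module_hom s t g \<longleftrightarrow> (\<forall>c a b. g (s c a + b) = t c (g a) + g b)"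
proof
  assume "module_hom s t g"
  then interpret module_hom s t g .
  show "\<forall>c a b. g (s c a + b) = t c (g a) + g b" by (simp add: add scale)
next
  interpret s: module s by fact
  interpret t: module t by fact
  assume *: "\<forall>c a b. g (s c a + b) = t c (g a) + g b"
  have add: "g (a + b) = g a + g b" for a b using *[rule_format, of 1 a b] by simp
  from add[of 0 0] have "g 0 = 0" by simp
  then have "g (s c a) = t c (g a)" for c a using *[rule_format, of c a 0] by simp
  with add show "module_hom s t g" by (simp add: module_hom_iff assms)
qed

definition letter_comb :: "('k \<Rightarrow> 'b::plus \<Rightarrow> 'b) \<Rightarrow> 'k \<Rightarrow> 'b \<Rightarrow> 'b \<Rightarrow> 'b \<Rightarrow> bool" where
  "letter_comb s c a b e \<longleftrightarrow> e = s c a + b"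

lemma Hom_tensor_iff:
  fixes s :: "'k::comm_ring_1 \<Rightarrow> 'b::ab_group_add \<Rightarrow> 'b"
    and t :: "'k \<Rightarrow> 'n::ab_group_add \<Rightarrow> 'n"
  assumes "module s" and "module t"
  shows "f \<in> Hom_tensor s t n \<longleftrightarrow>
    multilinear_word (letter_comb s) t n f \<and> (\<forall>as. length as \<noteq> n \<longrightarrow> f as = 0)"
proof -
  have "(\<forall>as i. length as = n \<longrightarrow> i < n \<longrightarrow> module_hom s t (\<lambda>a. f (as[i := a])))
    \<longleftrightarrow> multilinear_word (letter_comb s) t n f" (is "?A \<longleftrightarrow> ?B")
  proof
    assume A: ?A
    show ?B
      unfolding multilinear_word_def letter_comb_def
    proof (intro allI impI)
      fix p q :: "'b list" and c and a b e :: 'b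
      assume "Suc (length p + length q) = n" "e = s c a + b"
      with A[rule_format, of "p @ b # q" "length p"] module_hom_iff_comb[OF assms]
      show "f (p @ e # q) = t c (f (p @ a # q)) + f (p @ b # q)" by simp
    qed
  next
    assume B: ?B
    show ?A
    proof (intro allI impI)
      fix as :: "'b list" and i assume "length as = n" "i < n"
      then show "module_hom s t (\<lambda>a. f (as[i := a]))"
        using multilinear_wordD[OF B, of _ _ _ _ "take i as" "drop (Suc i) as"]
        by (simp add: module_hom_iff_comb[OF assms] letter_comb_def upd_conv_take_nth_drop)
    qed
  qed
  then show ?thesis by (simp add: Hom_tensor_def)
qed

text \<open>
  Letters from \<open>A\<close> and letters from \<open>M\<close> are never added to each other.
\<close>

fun mixed_comb ::
  "('k \<Rightarrow> 'a::plus \<Rightarrow> 'a) \<Rightarrow> ('k \<Rightarrow> 'm::plus \<Rightarrow> 'm) \<Rightarrow> 'k \<Rightarrow> 'a + 'm \<Rightarrow> 'a + 'm \<Rightarrow> 'a + 'm \<Rightarrow> bool" where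
  "mixed_comb sA sM c (Inl a) (Inl b) (Inl e) \<longleftrightarrow> e = sA c a + b"
| "mixed_comb sA sM c (Inr u) (Inr v) (Inr w) \<longleftrightarrow> w = sM c u + v"
| "mixed_comb sA sM c _ _ _ \<longleftrightarrow> False"

abbreviation M_count :: "('a + 'm) list \<Rightarrow> nat" where
  "M_count w \<equiv> length (filter (\<lambda>x. \<not> isl x) w)"

lemma mixed_word_iff: "mixed_word n w \<longleftrightarrow> length w = n \<and> M_count w = 1"
proof -
  have "(\<exists>!i. Q i) \<longleftrightarrow> (\<exists>i. Collect Q = {i})" for Q :: "nat \<Rightarrow> bool"
    unfolding set_eq_iff by auto
  then have "(\<exists>!i. i < length w \<and> \<not> isl (w ! i)) \<longleftrightarrow> M_count w = 1"
    unfolding length_filter_conv_card One_nat_def card_1_singleton_iff .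
  then show ?thesis by (auto simp: mixed_word_def)
qed

lemma pure_map_Inl: "list_all isl (map Inl as)"
  by (simp add: list_all_iff)

lemma list_all_isl_iff: "list_all isl w \<longleftrightarrow> M_count w = 0"
  by (induction w) auto

text \<open>
  The pair \<open>(\<alpha>, \<beta>)\<close> as a single cochain of the semidirect product of \<open>A\<close> and \<open>M\<close> with coefficients in
  itself. For cochains \<open>\<beta>\<close> the second component vanishes except on words with exactly one letter in \<open>M\<close>,
  so one obtains the graded part of weight zero.
\<close>

definition joint_cochain ::
  "('a list \<Rightarrow> 'a::zero) \<Rightarrow> (('a + 'm) list \<Rightarrow> 'm) \<Rightarrow> ('a + 'm) list \<Rightarrow> 'a \<times> 'm" where
  "joint_cochain \<alpha> \<beta> w = (if list_all isl w then \<alpha> (map projl w) else 0, \<beta> w)"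

lemma Hom_mixed_iff:
  fixes sA :: "'k::comm_ring_1 \<Rightarrow> 'a::ab_group_add \<Rightarrow> 'a"
    and sM :: "'k \<Rightarrow> 'm::ab_group_add \<Rightarrow> 'm"
  assumes "module sA" and "module sM"
  shows "\<beta> \<in> Hom_mixed sA sM n \<longleftrightarrow>
    multilinear_word (mixed_comb sA sM) sM n \<beta> \<and> (\<forall>w. \<not> mixed_word n w \<longrightarrow> \<beta> w = 0)"
    (is "_ \<longleftrightarrow> ?B \<and> ?Z")
proof -
  interpret M: module sM by fact
  note hom_iff = module_hom_iff_comb[OF assms(1,2)] module_hom_iff_comb[OF assms(2,2)]
  have "?B \<longleftrightarrow> (\<forall>w i. mixed_word n w \<longrightarrow> i < n \<longrightarrow>
            (if isl (w ! i) then module_hom sA sM (\<lambda>a. \<beta> (w[i := Inl a]))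
             else module_hom sM sM (\<lambda>u. \<beta> (w[i := Inr u]))))" (is "_ \<longleftrightarrow> ?A") if Z: ?Z
  proof
    assume A: ?A
    show ?B
      unfolding multilinear_word_def
    proof (intro allI impI)
      fix p q :: "('a + 'm) list" and c and a b e :: "'a + 'm"
      assume len: "Suc (length p + length q) = n" and comb: "mixed_comb sA sM c a b e"
      have mixed: "mixed_word n (p @ a # q) \<longleftrightarrow> mixed_word n (p @ b # q)"
        "mixed_word n (p @ e # q) \<longleftrightarrow> mixed_word n (p @ b # q)"
        using comb by (cases a; cases b; cases e; simp add: mixed_word_iff)+
      show "\<beta> (p @ e # q) = sM c (\<beta> (p @ a # q)) + \<beta> (p @ b # q)"
      proof (cases "mixed_word n (p @ b # q)")
        case True
        then show ?thesis
          using A[rule_format, OF True, of "length p"] comb len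
          by (cases a; cases b; cases e) (simp_all add: hom_iff)
      next
        case False
        then show ?thesis using Z mixed by simp
      qed
    qed
  next
    assume B: ?B
    show ?A
    proof (intro allI impI)
      fix w :: "('a + 'm) list" and i assume "mixed_word n w" "i < n"
      then have w: "length w = n" "i < length w" by (auto simp: mixed_word_def)
      have "\<beta> (w[i := e]) = sM c (\<beta> (w[i := a])) + \<beta> (w[i := b])"
        if "mixed_comb sA sM c a b e" for c a b e
        using multilinear_wordD[OF B that, of "take i w" "drop (Suc i) w"] w
        by (simp add: upd_conv_take_nth_drop)
      then show "if isl (w ! i) then module_hom sA sM (\<lambda>a. \<beta> (w[i := Inl a]))
             else module_hom sM sM (\<lambda>u. \<beta> (w[i := Inr u]))"
        by (simp add: hom_iff)
    qed
  qed
  then show ?thesis by (auto simp: Hom_mixed_def)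
qed

lemma Hom_mixed_pure:
  assumes "\<beta> \<in> Hom_mixed sA sM n" and "list_all isl w"
  shows "\<beta> w = 0"
  using assms by (auto simp: Hom_mixed_def mixed_word_iff list_all_isl_iff)

definition pair_scale :: "('k \<Rightarrow> 'a \<Rightarrow> 'a) \<Rightarrow> ('k \<Rightarrow> 'm \<Rightarrow> 'm) \<Rightarrow> 'k \<Rightarrow> 'a \<times> 'm \<Rightarrow> 'a \<times> 'm" where
  "pair_scale sA sM c y = (sA c (fst y), sM c (snd y))"

lemma multilinear_joint_iff:
  fixes sA :: "'k::comm_ring_1 \<Rightarrow> 'a::ab_group_add \<Rightarrow> 'a"
    and sM :: "'k \<Rightarrow> 'm::ab_group_add \<Rightarrow> 'm"
  assumes "module sA"
  shows "multilinear_word (mixed_comb sA sM) (pair_scale sA sM) n (joint_cochain \<alpha> \<beta>) \<longleftrightarrow>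
    multilinear_word (letter_comb sA) sA n \<alpha> \<and> multilinear_word (mixed_comb sA sM) sM n \<beta>"
    (is "?J \<longleftrightarrow> ?A \<and> ?B")
proof (intro iffI conjI)
  interpret A: module sA by fact
  assume J: ?J
  show ?A
    unfolding multilinear_word_def letter_comb_def
  proof (intro allI impI)
    fix p q :: "'a list" and c and a b e :: 'a
    assume "Suc (length p + length q) = n" "e = sA c a + b"
    then show "\<alpha> (p @ e # q) = sA c (\<alpha> (p @ a # q)) + \<alpha> (p @ b # q)"
      using multilinear_wordD[OF J, of c "Inl a" "Inl b" "Inl e" "map Inl p" "map Inl q"]
      by (simp add: joint_cochain_def pair_scale_def pure_map_Inl comp_def)
  qed
  show ?B
    using J by (auto simp: multilinear_word_def joint_cochain_def pair_scale_def)
next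
  interpret A: module sA by fact
  assume AB: "?A \<and> ?B"
  show ?J
    unfolding multilinear_word_def
  proof (intro allI impI)
    fix p q :: "('a + 'm) list" and c and a b e :: "'a + 'm"
    assume len: "Suc (length p + length q) = n" and comb: "mixed_comb sA sM c a b e"
    then show "joint_cochain \<alpha> \<beta> (p @ e # q)
        = pair_scale sA sM c (joint_cochain \<alpha> \<beta> (p @ a # q)) + joint_cochain \<alpha> \<beta> (p @ b # q)"
      using multilinear_wordD[OF conjunct2[OF AB] comb len]
        multilinear_wordD[OF conjunct1[OF AB], of c _ _ _ "map projl p" "map projl q"]
      by (cases a; cases b; cases e) (auto simp: joint_cochain_def pair_scale_def letter_comb_def)
  qed
qed

text \<open>
  Multiplication by a letter in the semidirect product; products of two elements of \<open>M\<close> are zero.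
\<close>

fun act_left :: "('a::{times,zero} \<Rightarrow> 'm \<Rightarrow> 'm) \<Rightarrow> ('m \<Rightarrow> 'a \<Rightarrow> 'm) \<Rightarrow> 'a + 'm \<Rightarrow> 'a \<times> 'm \<Rightarrow> 'a \<times> 'm" where
  "act_left l r (Inl a) y = (a * fst y, l a (snd y))"
| "act_left l r (Inr u) y = (0, r u (fst y))"

fun act_right :: "('a::{times,zero} \<Rightarrow> 'm \<Rightarrow> 'm) \<Rightarrow> ('m \<Rightarrow> 'a \<Rightarrow> 'm) \<Rightarrow> 'a \<times> 'm \<Rightarrow> 'a + 'm \<Rightarrow> 'a \<times> 'm" where
  "act_right l r y (Inl a) = (fst y * a, r (snd y) a)"
| "act_right l r y (Inr u) = (0, l (fst y) u)"

inductive indexed_comb :: "('k \<Rightarrow> 'm::plus \<Rightarrow> 'm) \<Rightarrow> 'k \<Rightarrow> 'x \<times> 'm \<Rightarrow> 'x \<times> 'm \<Rightarrow> 'x \<times> 'm \<Rightarrow> bool"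
  for sM where
  "indexed_comb sM c (x, u) (x, v) (x, sM c u + v)"

text \<open>
  A family indexed by words over \<open>X\<close> is the same as a function of words over \<open>X \<times> M\<close>.
\<close>

definition family_on_words :: "('x list \<Rightarrow> 'm list \<Rightarrow> 'a) \<Rightarrow> ('x \<times> 'm) list \<Rightarrow> 'a" where
  "family_on_words \<gamma> w = \<gamma> (map fst w) (map snd w)"

lemma RB_cochains_iff:
  fixes sA :: "'k::comm_ring_1 \<Rightarrow> 'a::ab_group_add \<Rightarrow> 'a"
    and sM :: "'k \<Rightarrow> 'm::ab_group_add \<Rightarrow> 'm"
    and \<gamma> :: "'x list \<Rightarrow> 'm list \<Rightarrow> 'a"
  assumes "module sA" and "module sM"
  shows "\<gamma> \<in> RB_cochains sA sM n \<longleftrightarrow>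
    multilinear_word (indexed_comb sM) sA n (family_on_words \<gamma>) \<and>
    (\<forall>xs us. length xs \<noteq> n \<or> length us \<noteq> n \<longrightarrow> \<gamma> xs us = 0)"
proof -
  have "(\<forall>xs. length xs = n \<longrightarrow> multilinear_word (letter_comb sM) sA n (\<gamma> xs))
    \<longleftrightarrow> multilinear_word (indexed_comb sM) sA n (family_on_words \<gamma>)" (is "?A \<longleftrightarrow> ?B")
  proof
    assume A: ?A
    show ?B
      unfolding multilinear_word_def
    proof (intro allI impI)
      fix p q :: "('x \<times> 'm) list" and a b e :: "'x \<times> 'm" and c
      assume len: "Suc (length p + length q) = n" and "indexed_comb sM c a b e"
      from this(2) show "family_on_words \<gamma> (p @ e # q)
        = sA c (family_on_words \<gamma> (p @ a # q)) + family_on_words \<gamma> (p @ b # q)"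
      proof cases
        case (1 x u v)
        show ?thesis
          using multilinear_wordD[OF A[rule_format, of "map fst p @ x # map fst q"], of c u v _ "map snd p" "map snd q"] len 1
          by (simp add: family_on_words_def letter_comb_def)
      qed
    qed
  next
    assume B: ?B
    show ?A
      unfolding multilinear_word_def letter_comb_def
    proof (intro allI impI)
      fix xs :: "'x list" and p q :: "'m list" and c and a b e :: 'm
      assume xs: "length xs = n" and len: "Suc (length p + length q) = n" and e: "e = sM c a + b"
      let ?k = "length p"
      have "xs = take ?k xs @ xs ! ?k # drop (Suc ?k) xs" using len xs by (simp add: id_take_nth_drop)
      then obtain y x z where y: "xs = y @ x # z" "length y = ?k" "length z = length q"
        using len xs by (metis add_diff_cancel_left' add_Suc diff_Suc_Suc length_append length_take length_Cons add_Suc_right min.absorb4 less_add_Suc1)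
      show "\<gamma> xs (p @ e # q) = sA c (\<gamma> xs (p @ a # q)) + \<gamma> xs (p @ b # q)"
        using multilinear_wordD[OF B indexed_comb.intros[of sM c x a b], of "zip y p" "zip z q"] y len e
        by (simp add: family_on_words_def)
    qed
  qed
  then show ?thesis
    unfolding RB_cochains_def Hom_tensor_iff[OF assms(2,1)] zero_fun_def
    by (auto simp: fun_eq_iff)
qed

section \<open>The two Hochschild complexes of a matching relative Rota-Baxter algebra\<close>

context matching_rel_RB_algebra
begin

lemma module_pair_scale: "module (pair_scale scaleA scaleM)"
  by unfold_locales
    (auto simp: pair_scale_def prod_eq_iff A.scale_right_distrib A.scale_left_distrib
      M.scale_right_distrib M.scale_left_distrib)

lemmas l_simps [simp] =
  module_hom.add[OF l_hom_A] module_hom.scale[OF l_hom_A] module_hom.diff[OF l_hom_A]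
  module_hom.zero[OF l_hom_A]
  module_hom.add[OF l_hom_M] module_hom.scale[OF l_hom_M] module_hom.diff[OF l_hom_M]
  module_hom.zero[OF l_hom_M]

lemmas r_simps [simp] =
  module_hom.add[OF r_hom_A] module_hom.scale[OF r_hom_A] module_hom.diff[OF r_hom_A]
  module_hom.zero[OF r_hom_A]
  module_hom.add[OF r_hom_M] module_hom.scale[OF r_hom_M] module_hom.diff[OF r_hom_M]
  module_hom.zero[OF r_hom_M]

lemmas P_simps [simp] =
  module_hom.add[OF P_hom] module_hom.scale[OF P_hom] module_hom.diff[OF P_hom]
  module_hom.zero[OF P_hom]

text \<open>
  The semidirect product of \<open>A\<close> and \<open>M\<close>, acting on itself from both sides. Two letters from \<open>M\<close> have the
  product \<open>Inr 0\<close>, so the product of letters is associative on the nose.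
\<close>

sublocale Mix: hochschild_data "pair_scale scaleA scaleM" "mixed_comb scaleA scaleM"
  "\<lambda>_::unit. mu_lr_sum l r" "act_left l r" "act_right l r"
proof (intro hochschild_data.intro module_pair_scale hochschild_data_axioms.intro)
  note [simp] = A.scale_mult_left A.scale_mult_right
  show "mixed_comb scaleA scaleM c (mu_lr_sum l r a z) (mu_lr_sum l r b z) (mu_lr_sum l r e z)"
    if "mixed_comb scaleA scaleM c a b e" for c a b e z
    using that by (cases a; cases b; cases e; cases z) (auto simp: distrib_right)
  show "mixed_comb scaleA scaleM c (mu_lr_sum l r z a) (mu_lr_sum l r z b) (mu_lr_sum l r z e)"
    if "mixed_comb scaleA scaleM c a b e" for c a b e z
    using that by (cases a; cases b; cases e; cases z) (auto simp: distrib_left)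
  show "act_left l r e y = pair_scale scaleA scaleM c (act_left l r a y) + act_left l r b y"
    if "mixed_comb scaleA scaleM c a b e" for c a b e y
    using that by (cases a; cases b; cases e) (auto simp: pair_scale_def distrib_right)
  show "act_right l r y e = pair_scale scaleA scaleM c (act_right l r y a) + act_right l r y b"
    if "mixed_comb scaleA scaleM c a b e" for c a b e y
    using that by (cases a; cases b; cases e) (auto simp: pair_scale_def distrib_left)
  show "act_left l r a (pair_scale scaleA scaleM c y + y')
      = pair_scale scaleA scaleM c (act_left l r a y) + act_left l r a y'" for a c y y'
    by (cases a) (auto simp: pair_scale_def distrib_left)
  show "act_right l r (pair_scale scaleA scaleM c y + y') a
      = pair_scale scaleA scaleM c (act_right l r y a) + act_right l r y' a" for a c y y'
    by (cases a) (auto simp: pair_scale_def distrib_right)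
  show "(\<Sum>j\<in>(UNIV :: unit set). act_left l r (mu_lr_sum l r a b) y) = act_left l r a (act_left l r b y)" for a b y
    by (cases a; cases b) (auto simp: UNIV_unit l_assoc r_assoc lr_assoc mult.assoc)
  show "(\<Sum>j\<in>(UNIV :: unit set). act_right l r y (mu_lr_sum l r a b)) = act_right l r (act_right l r y a) b" for a b y
    by (cases a; cases b) (auto simp: UNIV_unit l_assoc r_assoc lr_assoc mult.assoc)
  show "act_right l r (act_left l r a y) b = act_left l r a (act_right l r y b)" for a b y
    by (cases a; cases b) (auto simp: UNIV_unit l_assoc r_assoc lr_assoc mult.assoc)
  have "mu_lr_sum l r (mu_lr_sum l r a b) z = mu_lr_sum l r a (mu_lr_sum l r b z)" for a b z
    by (cases a; cases b; cases z) (auto simp: UNIV_unit l_assoc r_assoc lr_assoc mult.assoc)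
  then show "(\<Sum>i\<in>(UNIV :: unit set). \<Sum>j\<in>(UNIV :: unit set). F (mu_lr_sum l r (mu_lr_sum l r a b) z))
    = (\<Sum>i\<in>(UNIV :: unit set). \<Sum>j\<in>(UNIV :: unit set). (F (mu_lr_sum l r a (mu_lr_sum l r b z)) :: 'a \<times> 'm))" for F a b z
    by simp
qed

text \<open>
  The two halves of the product of \<open>(x, u)\<close> and \<open>(y, v)\<close> in the direct sum of copies of \<open>M\<close> indexed by
  \<open>X\<close>; they are the operations of the induced matching dendriform structure.
\<close>

fun dend :: "bool \<Rightarrow> 'x \<times> 'm \<Rightarrow> 'x \<times> 'm \<Rightarrow> 'x \<times> 'm" where
  "dend True (x, u) (y, v) = (x, r u (P y v))"
| "dend False (x, u) (y, v) = (y, l (P x u) v)"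

definition RB_left :: "'x \<times> 'm \<Rightarrow> 'a \<Rightarrow> 'a" where
  "RB_left z a = P (fst z) (snd z) * a - P (fst z) (r (snd z) a)"

definition RB_right :: "'a \<Rightarrow> 'x \<times> 'm \<Rightarrow> 'a" where
  "RB_right a z = a * P (fst z) (snd z) - P (fst z) (l a (snd z))"

text \<open>
  All the laws that involve both actions or two products come from the matching identity, which makes
  the sum of \<open>P\<close> over the two halves of a product equal to the product of the values of \<open>P\<close>.
\<close>

sublocale RB: hochschild_data scaleA "indexed_comb scaleM" dend RB_left RB_right
proof (intro hochschild_data.intro A.module_axioms hochschild_data_axioms.intro)
  note [simp] = A.scale_mult_left A.scale_mult_right
  show "indexed_comb scaleM c (dend j a z) (dend j b z) (dend j e z)"
    if "indexed_comb scaleM c a b e" for c a b e j z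
    using that by cases (cases j; cases z; simp add: indexed_comb.intros)
  show "indexed_comb scaleM c (dend j z a) (dend j z b) (dend j z e)"
    if "indexed_comb scaleM c a b e" for c a b e j z
    using that by cases (cases j; cases z; simp add: indexed_comb.intros)
  show "RB_left e y = scaleA c (RB_left a y) + RB_left b y"
    if "indexed_comb scaleM c a b e" for c a b e y
    using that by cases (auto simp: RB_left_def algebra_simps A.scale_right_diff_distrib)
  show "RB_right y e = scaleA c (RB_right y a) + RB_right y b"
    if "indexed_comb scaleM c a b e" for c a b e y
    using that by cases (auto simp: RB_right_def algebra_simps A.scale_right_diff_distrib)
  show "RB_left a (scaleA c y + y') = scaleA c (RB_left a y) + RB_left a y'" for a c y y'
    by (auto simp: RB_left_def algebra_simps A.scale_right_diff_distrib)
  show "RB_right (scaleA c y + y') a = scaleA c (RB_right y a) + RB_right y' a" for a c y y'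
    by (auto simp: RB_right_def algebra_simps A.scale_right_diff_distrib)
  show "(\<Sum>j\<in>UNIV. RB_left (dend j a b) y) = RB_left a (RB_left b y)" for a b y
    by (cases a; cases b)
      (simp add: UNIV_bool RB_left_def right_diff_distrib mult.assoc[symmetric] r_assoc lr_assoc
        P_matching distrib_right)
  show "(\<Sum>j\<in>UNIV. RB_right y (dend j a b)) = RB_right (RB_right y a) b" for a b y
    by (cases a; cases b)
      (simp add: UNIV_bool RB_right_def left_diff_distrib mult.assoc l_assoc lr_assoc
        P_matching distrib_left)
  show "RB_right (RB_left a y) b = RB_left a (RB_right y b)" for a b y
    by (cases a; cases b)
      (simp add: RB_left_def RB_right_def left_diff_distrib right_diff_distrib mult.assoc
        l_assoc r_assoc lr_assoc P_matching)
  fix F :: "'x \<times> 'm \<Rightarrow> 'a" and a b z :: "'x \<times> 'm"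
  assume F: "\<And>c a b e. indexed_comb scaleM c a b e \<Longrightarrow> F e = scaleA c (F a) + F b"
  have add: "F (x, u + v) = F (x, u) + F (x, v)" for x u v
    using F[OF indexed_comb.intros[of scaleM 1 x u v]] by simp
  obtain x u y v q w where [simp]: "a = (x, u)" "b = (y, v)" "z = (q, w)" by (metis surj_pair)
  \<comment> \<open>On each side two of the four letters carry the same index; their sum is a single letter
    by the matching identity.\<close>
  have "F (q, l (P x (r u (P y v))) w) + F (q, l (P y (l (P x u) v)) w) = F (q, l (P x u) (l (P y v) w))"
    unfolding add[symmetric] l_assoc[symmetric] P_matching by simp
  moreover have "F (x, r u (P y (r v (P q w)))) + F (x, r u (P q (l (P y v) w))) = F (x, r (r u (P y v)) (P q w))"
    unfolding add[symmetric] r_assoc[symmetric] P_matching by simp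
  ultimately show "(\<Sum>i\<in>UNIV. \<Sum>j\<in>UNIV. F (dend j (dend i a b) z))
      = (\<Sum>i\<in>UNIV. \<Sum>j\<in>UNIV. F (dend j a (dend i b z)))"
    by (simp add: UNIV_bool lr_assoc add_ac)
qed


section \<open>Identification of the coboundaries\<close>

lemma act_left_joint:
  assumes "\<And>w. list_all isl w \<Longrightarrow> \<beta> w = 0"
  shows "act_left l r y (joint_cochain \<alpha> \<beta> v) =
    (if list_all isl (y # v) then projl y * \<alpha> (map projl v) else 0,
     lr_sum l r y (alpha_beta_sum \<alpha> \<beta> v))"
  using assms by (cases y) (auto simp: joint_cochain_def alpha_beta_sum_def)

lemma act_right_joint:
  assumes "\<And>w. list_all isl w \<Longrightarrow> \<beta> w = 0"
  shows "act_right l r (joint_cochain \<alpha> \<beta> v) y =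
    (if list_all isl (y # v) then \<alpha> (map projl v) * projl y else 0,
     lr_sum l r (alpha_beta_sum \<alpha> \<beta> v) y)"
  using assms by (cases y) (auto simp: joint_cochain_def alpha_beta_sum_def)

text \<open>
  By this lemma and the next one the component in \<open>M\<close> of the Hochschild coboundary of a joint cochain
  vanishes on all words that are not mixed, as \<open>\<delta>\<^sup>\<alpha> \<beta>\<close> does by definition.
\<close>

lemma lr_sum_eq_0:
  assumes "\<beta> \<in> Hom_mixed scaleA scaleM n" and "length v = n" and "M_count (y # v) \<noteq> 1"
  shows "lr_sum l r y (alpha_beta_sum \<alpha> \<beta> v) = 0"
    and "lr_sum l r (alpha_beta_sum \<alpha> \<beta> v) y = 0"
  using assms
  by (cases y; auto simp: alpha_beta_sum_def Hom_mixed_def mixed_word_iff list_all_isl_iff)+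

lemma mu_lr_sum_eq_0:
  assumes "\<beta> \<in> Hom_mixed scaleA scaleM n"
    and "length (p @ x # y # q) = Suc n" and "M_count (p @ x # y # q) \<noteq> 1"
  shows "\<beta> (p @ mu_lr_sum l r x y # q) = 0"
proof (cases "\<not> isl x \<and> \<not> isl y")
  case True
  then obtain u v where "x = Inr u" "y = Inr v" by (cases x; cases y) auto
  \<comment> \<open>The word may have lost a letter in \<open>M\<close> and become mixed, but it contains the zero of \<open>M\<close>.\<close>
  moreover have "\<beta> (p @ Inr 0 # q) = \<beta> (p @ Inr 0 # q) + \<beta> (p @ Inr 0 # q)"
    using multilinear_wordD[of "mixed_comb scaleA scaleM" scaleM n \<beta> 1 "Inr 0" "Inr 0" "Inr 0" p q] assms
    by (simp add: Hom_mixed_iff A.module_axioms M.module_axioms)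
  ultimately show ?thesis by simp
next
  case False
  then have "M_count (p @ mu_lr_sum l r x y # q) = M_count (p @ x # y # q)"
    by (cases x; cases y) auto
  then have "\<not> mixed_word n (p @ mu_lr_sum l r x y # q)"
    using assms(3) by (simp only: mixed_word_iff) simp
  then show ?thesis using assms(1) by (simp add: Hom_mixed_def)
qed

lemma contract_joint:
  assumes "length w = Suc n" and "i \<in> {1..n}"
  shows "joint_cochain \<alpha> \<beta> (take (i - 1) w @ [mu_lr_sum l r (w ! (i - 1)) (w ! i)] @ drop (i + 1) w) =
    (if list_all isl w then
       \<alpha> (take (i - 1) (map projl w) @ [map projl w ! (i - 1) * map projl w ! i] @ drop (i + 1) (map projl w))
     else 0, \<beta> (take (i - 1) w @ [mu_lr_sum l r (w ! (i - 1)) (w ! i)] @ drop (i + 1) w))"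
proof -
  obtain k where k: "i = Suc k" using assms by (cases i) auto
  have "w = take k w @ w ! k # w ! Suc k # drop (Suc (Suc k)) w"
    using assms k by (simp add: Cons_nth_drop_Suc)
  then obtain p x y q where w: "w = p @ x # y # q" "length p = k"
    using assms k by (metis atLeastAtMost_iff Suc_leD le_SucI length_take min.absorb2)
  show ?thesis
    using k w by (cases x; cases y) (auto simp: joint_cochain_def nth_append)
qed

lemma coboundary_joint:
  assumes \<beta>: "\<beta> \<in> Hom_mixed scaleA scaleM n"
  shows "Mix.coboundary n (joint_cochain \<alpha> \<beta>) =
    joint_cochain (delta_Hoch n \<alpha>) (delta_Hoch_mixed l r n \<alpha> \<beta>)"
proof
  fix w :: "('a + 'm) list"
  show "Mix.coboundary n (joint_cochain \<alpha> \<beta>) w =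
    joint_cochain (delta_Hoch n \<alpha>) (delta_Hoch_mixed l r n \<alpha> \<beta>) w"
  proof (cases "length w = Suc n")
    case False
    then show ?thesis
      by (simp add: Mix.coboundary_def joint_cochain_def delta_Hoch_def delta_Hoch_mixed_def
          mixed_word_def zero_prod_def)
  next
    case len: True
    then have ne: "w \<noteq> []" by auto
    note pure = Hom_mixed_pure[OF \<beta>]
    let ?J = "joint_cochain \<alpha> \<beta>" and ?c = "list_all isl w"
    let ?v = "\<lambda>i. take (i - 1) w @ [mu_lr_sum l r (w ! (i - 1)) (w ! i)] @ drop (i + 1) w"
    let ?as = "map projl w"
    let ?L = "act_left l r (hd w) (?J (tl w))" and ?R = "act_right l r (?J (butlast w)) (last w)"
    let ?S = "\<Sum>i = 1..n. alt_sign i (?J (?v i))"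
    have cb: "Mix.coboundary n ?J w = ?L + ?S + alt_sign (n + 1) ?R"
      using Mix.coboundary_eq[OF len, of ?J] by (simp add: UNIV_unit)
    have fst_sgn: "fst (alt_sign i y) = alt_sign i (fst y)"
      and snd_sgn: "snd (alt_sign i y) = alt_sign i (snd y)" for i and y :: "'a \<times> 'm"
      by (auto simp: alt_sign_def)
    have hd_tl: "w = hd w # tl w" and bl: "w = butlast w @ [last w]" using ne by auto
    have pure_tl: "list_all isl (hd w # tl w) \<longleftrightarrow> ?c" using hd_tl by simp
    have pure_bl: "list_all isl (last w # butlast w) \<longleftrightarrow> ?c"
      by (subst (3) bl) (auto simp del: append_butlast_last_id)
    have actL: "?L = (if ?c then projl (hd w) * \<alpha> (map projl (tl w)) else 0,
        lr_sum l r (hd w) (alpha_beta_sum \<alpha> \<beta> (tl w)))"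
      using act_left_joint[of \<beta> "hd w" \<alpha> "tl w"] pure pure_tl by simp
    have actR: "?R = (if ?c then \<alpha> (map projl (butlast w)) * projl (last w) else 0,
        lr_sum l r (alpha_beta_sum \<alpha> \<beta> (butlast w)) (last w))"
      using act_right_joint[of \<beta> \<alpha> "butlast w" "last w"] pure pure_bl by simp
    have S: "?S = (\<Sum>i = 1..n. alt_sign i (if ?c then
       \<alpha> (take (i - 1) ?as @ [?as ! (i - 1) * ?as ! i] @ drop (i + 1) ?as) else 0, \<beta> (?v i)))"
      by (rule sum.cong[OF refl]) (use contract_joint[OF len, of _ \<alpha> \<beta>] in simp)
    have "fst (Mix.coboundary n ?J w) = (if ?c then delta_Hoch n \<alpha> ?as else 0)"
      unfolding cb actL actR S using len ne
      by (auto simp: fst_sum fst_sgn delta_Hoch_def hd_map map_tl map_butlast last_map)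
    moreover have "snd (Mix.coboundary n ?J w) = delta_Hoch_mixed l r n \<alpha> \<beta> w"
    proof (cases "M_count w = 1")
      case True
      then show ?thesis
        unfolding cb actL actR S using len
        by (simp add: snd_sum snd_sgn delta_Hoch_mixed_def mixed_word_iff)
    next
      case False
      have "M_count (hd w # tl w) \<noteq> 1" using False hd_tl by simp
      moreover have "M_count (last w # butlast w) \<noteq> 1"
        using False arg_cong[OF bl, of M_count]
        by (simp del: append_butlast_last_id split: if_splits)
      moreover have "\<beta> (?v i) = 0" if "i \<in> {1..n}" for i
      proof -
        have "w = take (i - 1) w @ w ! (i - 1) # w ! i # drop (i + 1) w"
          using that len by (cases i) (auto simp: Cons_nth_drop_Suc)
        then show ?thesis
          using mu_lr_sum_eq_0[OF \<beta>, of "take (i - 1) w" "w ! (i - 1)" "w ! i" "drop (i + 1) w"]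
            False len by simp
      qed
      ultimately show ?thesis
        unfolding cb actL actR S using len False lr_sum_eq_0[OF \<beta>]
        by (simp add: snd_sum snd_sgn delta_Hoch_mixed_def mixed_word_iff)
    qed
    ultimately show ?thesis by (simp add: prod_eq_iff joint_cochain_def)
  qed
qed

text \<open>
  The two sums over \<open>i\<close> in the coboundary of families come from the two halves of the product: the first
  half keeps the index of its left factor, the second that of its right factor.
\<close>

lemma coboundary_family:
  "RB.coboundary n (family_on_words \<gamma>) = family_on_words (delta_RB l r P n \<gamma>)"
proof
  fix w :: "('x \<times> 'm) list"
  show "RB.coboundary n (family_on_words \<gamma>) w = family_on_words (delta_RB l r P n \<gamma>) w"
  proof (cases "length w = Suc n")
    case False
    then show ?thesis by (simp add: RB.coboundary_def family_on_words_def delta_RB_def)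
  next
    case len: True
    then have ne: "w \<noteq> []" by auto
    let ?xs = "map fst w" and ?us = "map snd w"
    have dend: "dend True a b = (fst a, r (snd a) (P (fst b) (snd b)))"
      "dend False a b = (fst b, l (P (fst a) (snd a)) (snd b))" for a b
      by (cases a; cases b; simp)+
    have "(\<Sum>j\<in>UNIV. family_on_words \<gamma> (take (i - 1) w @ [dend j (w ! (i - 1)) (w ! i)] @ drop (i + 1) w))
      = \<gamma> (take i ?xs @ drop (i + 1) ?xs)
          (take (i - 1) ?us @ [r (?us ! (i - 1)) (P (?xs ! i) (?us ! i))] @ drop (i + 1) ?us)
      + \<gamma> (take (i - 1) ?xs @ drop i ?xs)
          (take (i - 1) ?us @ [l (P (?xs ! (i - 1)) (?us ! (i - 1))) (?us ! i)] @ drop (i + 1) ?us)"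
      if i: "i \<in> {1..n}" for i
    proof -
      obtain k where k: "i = Suc k" using i by (cases i) auto
      have "take i ?xs = take (i - 1) ?xs @ [?xs ! (i - 1)]"
        using i len k by (simp add: take_Suc_conv_app_nth)
      moreover have "drop i ?xs = ?xs ! i # drop (i + 1) ?xs"
        using i len Cons_nth_drop_Suc[of i ?xs] by simp
      moreover have "i - 1 < length w" using i len k by simp
      ultimately show ?thesis
        using i len by (simp add: UNIV_bool family_on_words_def dend take_map drop_map add.commute)
    qed
    note sum.cong[OF refl arg_cong[where f = "alt_sign _", OF this], of "{1..n}"]
    then show ?thesis
      unfolding RB.coboundary_eq[OF len] using len ne
      by (simp add: alt_sign_add sum.distrib family_on_words_def delta_RB_def RB_left_def RB_right_def
          alt_sign_diff hd_map last_map map_tl map_butlast add_ac)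
  qed
qed


section \<open>Pulling cochains back along the Rota-Baxter operators\<close>

definition apply_P :: "'x \<times> 'm \<Rightarrow> 'a + 'm" where
  "apply_P z = Inl (P (fst z) (snd z))"

text \<open>
  The sum over \<open>i\<close> of \<open>P\<^sub>x (g (\<dots>))\<close> with \<open>x\<close> the index at \<open>i\<close>, where \<open>g\<close> gets the entry \<open>u\<close> at \<open>i\<close>
  unchanged and the images under \<open>P\<close> of all the others. The recursion on the word, with a changing \<open>g\<close>,
  gives a splitting rule for concatenations, so that no index arithmetic is needed for the faces.
\<close>

fun insertion_sum :: "(('a + 'm) list \<Rightarrow> 'm) \<Rightarrow> ('x \<times> 'm) list \<Rightarrow> 'a" where
  "insertion_sum g [] = 0"
| "insertion_sum g (z # w) =
     P (fst z) (g (Inr (snd z) # map apply_P w)) + insertion_sum (\<lambda>v. g (apply_P z # v)) w"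

lemma insertion_sum_append:
  "insertion_sum g (p @ q) =
    insertion_sum (\<lambda>v. g (v @ map apply_P q)) p + insertion_sum (\<lambda>v. g (map apply_P p @ v)) q"
  by (induction p arbitrary: g) (auto simp: add.assoc)

lemma insertion_sum_cong:
  "(\<And>v. length v = length w \<Longrightarrow> g v = g' v) \<Longrightarrow> insertion_sum g w = insertion_sum g' w"
proof (induction w arbitrary: g g')
  case (Cons z w)
  have "insertion_sum (\<lambda>v. g (apply_P z # v)) w = insertion_sum (\<lambda>v. g' (apply_P z # v)) w"
    by (rule Cons.IH) (simp add: Cons.prems)
  then show ?case by (simp add: Cons.prems)
qed simp

lemma insertion_sum_comb:
  "insertion_sum (\<lambda>v. scaleM c (g v) + g' v) w = scaleA c (insertion_sum g w) + insertion_sum g' w"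
  by (induction w arbitrary: g g') (auto simp: A.scale_right_distrib add_ac)

lemma insertion_sum_add:
  "insertion_sum (\<lambda>v. g v + g' v) w = insertion_sum g w + insertion_sum g' w"
  using insertion_sum_comb[of 1 g g' w] by simp

lemma insertion_sum_zero [simp]: "insertion_sum (\<lambda>v. 0) w = 0"
  by (induction w) auto

text \<open>
  The outer faces: the action of a letter subtracts from \<open>P\<^sub>x u P\<^sub>y m\<close> exactly the first summand
  \<open>P\<^sub>x (u P\<^sub>y m)\<close> of the matching identity, and \<open>P\<^sub>y ((P\<^sub>x u) m)\<close> is left. The mirror image is the
  lemma after this one.
\<close>

lemma insertion_sum_l:
  "RB_left z (insertion_sum g w) = insertion_sum (\<lambda>v. l (P (fst z) (snd z)) (g v)) w"
proof (induction w arbitrary: g)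
  case (Cons y w)
  show ?case
    using Cons[of "\<lambda>v. g (apply_P y # v)"]
    by (simp add: RB.L_add) (simp add: RB_left_def P_matching)
qed simp

lemma insertion_sum_r:
  "RB_right (insertion_sum g w) z = insertion_sum (\<lambda>v. r (g v) (P (fst z) (snd z))) w"
proof (induction w arbitrary: g)
  case (Cons y w)
  show ?case
    using Cons[of "\<lambda>v. g (apply_P y # v)"]
    by (simp add: RB.R_add) (simp add: RB_right_def P_matching)
qed simp

text \<open>
  The map \<open>h\<close> without its sign, on joint cochains.
\<close>

definition pullback :: "(('a + 'm) list \<Rightarrow> 'a \<times> 'm) \<Rightarrow> ('x \<times> 'm) list \<Rightarrow> 'a" where
  "pullback F w = fst (F (map apply_P w)) - insertion_sum (\<lambda>v. snd (F v)) w"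

lemma pullback_comb:
  "pullback (\<lambda>v. pair_scale scaleA scaleM c (F v) + G v) w = scaleA c (pullback F w) + pullback G w"
  by (simp add: pullback_def pair_scale_def insertion_sum_comb A.scale_right_diff_distrib)

lemma pullback_zero [simp]: "pullback (\<lambda>v. 0) w = 0"
  by (simp add: pullback_def)

lemma pullback_alternating_sum:
  assumes "finite I"
  shows "pullback (\<lambda>v. \<Sum>i\<in>I. alt_sign i (F i v)) w = (\<Sum>i\<in>I. alt_sign i (pullback (F i) w))"
  using assms
proof (induction I rule: finite_induct)
  case (insert i I)
  have "pair_scale scaleA scaleM 1 y = y" "pair_scale scaleA scaleM (- 1) y = - y" for y
    by (auto simp: pair_scale_def prod_eq_iff)
  then have "pullback (\<lambda>v. alt_sign i (F i v) + G v) w = alt_sign i (pullback (F i) w) + pullback G w" for G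
    using pullback_comb[of 1 "F i" G w] pullback_comb[of "- 1" "F i" G w] by (simp add: alt_sign_def)
  then show ?case using insert by simp
qed simp

lemma pullback_append:
  "pullback F (p @ z # q) = fst (F (map apply_P p @ apply_P z # map apply_P q))
    - insertion_sum (\<lambda>v. snd (F (v @ apply_P z # map apply_P q))) p
    - P (fst z) (snd (F (map apply_P p @ Inr (snd z) # map apply_P q)))
    - insertion_sum (\<lambda>v. snd (F (map apply_P p @ apply_P z # v))) q"
  by (simp add: pullback_def insertion_sum_append)

lemma multilinear_pullback:
  assumes F: "multilinear_word (mixed_comb scaleA scaleM) (pair_scale scaleA scaleM) n F"
  shows "multilinear_word (indexed_comb scaleM) scaleA n (pullback F)"
  unfolding multilinear_word_def
proof (intro allI impI)
  fix p q :: "('x \<times> 'm) list" and c and a b e :: "'x \<times> 'm"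
  assume len: "Suc (length p + length q) = n" and "indexed_comb scaleM c a b e"
  then obtain x u v where abe: "a = (x, u)" "b = (x, v)" "e = (x, scaleM c u + v)"
    by (auto elim: indexed_comb.cases)
  have F1: "F (p' @ apply_P e # q')
      = pair_scale scaleA scaleM c (F (p' @ apply_P a # q')) + F (p' @ apply_P b # q')"
    and F2: "F (p' @ Inr (snd e) # q')
      = pair_scale scaleA scaleM c (F (p' @ Inr (snd a) # q')) + F (p' @ Inr (snd b) # q')"
    if "length p' = length p" "length q' = length q" for p' q'
    using that len by (auto intro!: multilinear_wordD[OF F] simp: abe apply_P_def)
  have "insertion_sum (\<lambda>v. snd (F (v @ apply_P e # map apply_P q))) p
      = insertion_sum (\<lambda>v. scaleM c (snd (F (v @ apply_P a # map apply_P q)))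
          + snd (F (v @ apply_P b # map apply_P q))) p"
    by (rule insertion_sum_cong) (simp add: F1 pair_scale_def)
  moreover have "insertion_sum (\<lambda>v. snd (F (map apply_P p @ apply_P e # v))) q
      = insertion_sum (\<lambda>v. scaleM c (snd (F (map apply_P p @ apply_P a # v)))
          + snd (F (map apply_P p @ apply_P b # v))) q"
    by (rule insertion_sum_cong) (simp add: F1 pair_scale_def)
  ultimately show "pullback F (p @ e # q) = scaleA c (pullback F (p @ a # q)) + pullback F (p @ b # q)"
    unfolding pullback_append
    by (simp only: F1[of "map apply_P p" "map apply_P q"] F2[of "map apply_P p" "map apply_P q"] 
        length_map insertion_sum_comb)
      (simp add: pair_scale_def abe A.scale_right_diff_distrib)
qed

text \<open>
  The sign-free form of \<open>h\<close> commutes with every face. For an inner face at the letters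
  \<open>(x, u)\<close> and \<open>(y, v)\<close>, the two halves of their product have the images \<open>P\<^sub>x (u P\<^sub>y v)\<close> and
  \<open>P\<^sub>y ((P\<^sub>x u) v)\<close> with sum \<open>P\<^sub>x u P\<^sub>y v\<close>. This accounts for \<open>\<alpha>\<close> and for the insertions outside of
  the contracted letters; the insertions at these two letters match one half each.
\<close>

lemma pullback_face:
  assumes F: "multilinear_word (mixed_comb scaleA scaleM) (pair_scale scaleA scaleM) n F"
    and len: "length w = Suc n" and i: "i \<le> Suc n"
  shows "RB.face n i (pullback F) w = pullback (Mix.face n i F) w"
proof -
  consider "i = 0" | "i = Suc n" | k where "i = Suc k" "Suc k \<le> n"
    using i by (metis le_SucE not0_implies_Suc)
  then show ?thesis
  proof cases
    case 1
    obtain z w' where w: "w = z # w'" using len by (cases w) auto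
    have "RB_left z (pullback F w')
        = RB_left z (fst (F (map apply_P w'))) - RB_left z (insertion_sum (\<lambda>v. snd (F v)) w')"
      by (simp add: pullback_def RB_left_def algebra_simps)
    then have "RB_left z (pullback F w') = P (fst z) (snd z) * fst (F (map apply_P w'))
        - P (fst z) (r (snd z) (fst (F (map apply_P w'))))
        - insertion_sum (\<lambda>v. l (P (fst z) (snd z)) (snd (F v))) w'"
      by (simp only: insertion_sum_l) (simp add: RB_left_def)
    then show ?thesis
      using 1 w by (simp add: RB.face_def Mix.face_def pullback_def apply_P_def algebra_simps)
  next
    case 2
    obtain w' z where w: "w = w' @ [z]" using len by (cases w rule: rev_cases) auto
    have "RB_right (pullback F w') z
        = RB_right (fst (F (map apply_P w'))) z - RB_right (insertion_sum (\<lambda>v. snd (F v)) w') z"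
      by (simp add: pullback_def RB_right_def algebra_simps)
    then have "RB_right (pullback F w') z = fst (F (map apply_P w')) * P (fst z) (snd z)
        - P (fst z) (l (fst (F (map apply_P w'))) (snd z))
        - insertion_sum (\<lambda>v. r (snd (F v)) (P (fst z) (snd z))) w'"
      by (simp only: insertion_sum_r) (simp add: RB_right_def)
    then show ?thesis
      using 2 w
      by (simp add: RB.face_def Mix.face_def pullback_def apply_P_def insertion_sum_append algebra_simps)
  next
    case (3 k)
    then have "w = take k w @ w ! k # w ! Suc k # drop (Suc (Suc k)) w"
      using len by (simp add: Cons_nth_drop_Suc)
    moreover have "length (take k w) = k" using 3 len by simp
    ultimately obtain p y z q where w: "w = p @ y # z # q" "k = length p" by metis
    obtain x u x' u' where yz: "y = (x, u)" "z = (x', u')" by (metis surj_pair)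
    let ?T = "dend True y z" and ?F = "dend False y z" and ?yz = "Inl (P x u * P x' u')"
    have prod: "F (p' @ ?yz # q') = F (p' @ apply_P ?T # q') + F (p' @ apply_P ?F # q')"
      if "length p' = length p" "length q' = length q" for p' q'
      using multilinear_wordD[OF F, of 1 "apply_P ?T" "apply_P ?F" ?yz p' q'] that len
      by (simp add: yz w apply_P_def P_matching pair_scale_def)
    have "insertion_sum (\<lambda>v. snd (F (v @ ?yz # map apply_P q))) p
      = insertion_sum (\<lambda>v. snd (F (v @ apply_P ?T # map apply_P q))
          + snd (F (v @ apply_P ?F # map apply_P q))) p"
      by (rule insertion_sum_cong) (simp add: prod)
    moreover have "insertion_sum (\<lambda>v. snd (F (map apply_P p @ ?yz # v))) q
      = insertion_sum (\<lambda>v. snd (F (map apply_P p @ apply_P ?T # v))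
          + snd (F (map apply_P p @ apply_P ?F # v))) q"
      by (rule insertion_sum_cong) (simp add: prod)
    moreover have "pullback (\<lambda>v. F (contract (mu_lr_sum l r) k v)) w =
      fst (F (map apply_P p @ ?yz # map apply_P q))
      - insertion_sum (\<lambda>v. snd (F (v @ ?yz # map apply_P q))) p
      - P x (snd (F (map apply_P p @ Inr (snd ?T) # map apply_P q)))
      - P x' (snd (F (map apply_P p @ Inr (snd ?F) # map apply_P q)))
      - insertion_sum (\<lambda>v. snd (F (map apply_P p @ ?yz # v))) q"
    proof -
      have *: "contract (mu_lr_sum l r) k (v @ a # b # s) = v @ mu_lr_sum l r a b # s"
        if "length v = length p" for v a b s
        using contract_at[of "mu_lr_sum l r" v a b s] that w by simp
      have "insertion_sum (\<lambda>v. snd (F (contract (mu_lr_sum l r) k (v @ apply_P y # apply_P z # map apply_P q)))) p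
        = insertion_sum (\<lambda>v. snd (F (v @ ?yz # map apply_P q))) p"
        by (rule insertion_sum_cong) (simp add: *, simp add: apply_P_def yz)
      then show ?thesis
        unfolding w(1) pullback_append
        by (simp add: *) (simp add: apply_P_def yz)
    qed
    ultimately have "pullback (\<lambda>v. F (contract (mu_lr_sum l r) k v)) w
        = pullback F (p @ ?F # q) + pullback F (p @ ?T # q)"
      unfolding pullback_append
      by (simp only: insertion_sum_add prod[of "map apply_P p" "map apply_P q"] length_map)
        (simp add: yz)
    moreover have "RB.face n i (pullback F) w = pullback F (p @ ?F # q) + pullback F (p @ ?T # q)"
      using 3 w contract_at[of _ p y z q] by (simp add: RB.face_def UNIV_bool)
    moreover have "Mix.face n i F = (\<lambda>v. F (contract (mu_lr_sum l r) k v))"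
      using 3 by (simp add: fun_eq_iff Mix.face_def UNIV_unit)
    ultimately show ?thesis by simp
  qed
qed

lemma pullback_coboundary:
  assumes F: "multilinear_word (mixed_comb scaleA scaleM) (pair_scale scaleA scaleM) n F"
    and len: "length w = Suc n"
  shows "RB.coboundary n (pullback F) w = pullback (Mix.coboundary n F) w"
proof -
  have "pullback (Mix.coboundary n F) w = pullback (\<lambda>v. \<Sum>i\<le>Suc n. alt_sign i (Mix.face n i F v)) w"
    unfolding pullback_def
    using len by (intro arg_cong2[where f = minus] insertion_sum_cong)
      (auto simp: Mix.coboundary_def simp del: sum.atMost_Suc)
  then show ?thesis
    using pullback_face[OF F len] len
    by (simp add: RB.coboundary_def pullback_alternating_sum del: sum.atMost_Suc)
qed

lemma family_h_RB:
  assumes \<beta>: "\<beta> \<in> Hom_mixed scaleA scaleM n"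
  shows "family_on_words (h_RB P n \<alpha> \<beta>) w =
    (if length w = n then alt_sign n (pullback (joint_cochain \<alpha> \<beta>) w) else 0)"
proof -
  have "insertion_sum g w = (\<Sum>i<length w. P (map fst w ! i)
      (g ((map apply_P w)[i := Inr (map snd w ! i)])))" for g
  proof (induction w arbitrary: g)
    case (Cons z w)
    show ?case
      using Cons[of "\<lambda>v. g (apply_P z # v)"] by (simp add: sum.lessThan_Suc_shift del: sum.lessThan_Suc)
  qed simp
  then have *: "insertion_sum g w = (\<Sum>i = 1..length w. P (map fst w ! (i - 1))
      (g ((map apply_P w)[i - 1 := Inr (map snd w ! (i - 1))])))" for g
    by (simp add: sum.atLeast1_atMost_eq)
  have "map Inl (map2 P (map fst w) (map snd w)) = map apply_P w"
    by (induction w) (auto simp: apply_P_def)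
  moreover have "map projl (map apply_P w) = map2 P (map fst w) (map snd w)" "list_all isl (map apply_P w)"
    by (induction w) (auto simp: apply_P_def)
  ultimately show ?thesis
    by (simp add: family_on_words_def h_RB_def pullback_def joint_cochain_def *)
qed


section \<open>The cochain complex\<close>

lemma Hom_iff_joint:
  "\<alpha> \<in> Hom_tensor scaleA scaleA n \<and> \<beta> \<in> Hom_mixed scaleA scaleM n \<longleftrightarrow>
    multilinear_word (mixed_comb scaleA scaleM) (pair_scale scaleA scaleM) n (joint_cochain \<alpha> \<beta>) \<and>
    (\<forall>as. length as \<noteq> n \<longrightarrow> \<alpha> as = 0) \<and> (\<forall>w. \<not> mixed_word n w \<longrightarrow> \<beta> w = 0)"
  unfolding Hom_tensor_iff[OF A.module_axioms A.module_axioms]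
    Hom_mixed_iff[OF A.module_axioms M.module_axioms] multilinear_joint_iff[OF A.module_axioms]
  by blast

lemma joint_cochain_eqI:
  assumes "joint_cochain \<alpha> \<beta> = joint_cochain \<alpha>' \<beta>'"
  shows "\<alpha> = \<alpha>'" and "\<beta> = \<beta>'"
proof
  show "\<alpha> as = \<alpha>' as" for as
    using fun_cong[OF assms, of "map Inl as"] by (simp add: joint_cochain_def pure_map_Inl comp_def)
  show "\<beta> = \<beta>'" using fun_cong[OF assms] by (auto simp: joint_cochain_def)
qed

lemma joint_cochain_comb:
  "joint_cochain (\<lambda>as. scaleA c (\<alpha> as) + \<alpha>' as) (\<lambda>w. scaleM c (\<beta> w) + \<beta>' w) =
    (\<lambda>w. pair_scale scaleA scaleM c (joint_cochain \<alpha> \<beta> w) + joint_cochain \<alpha>' \<beta>' w)"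
  by (auto simp: joint_cochain_def pair_scale_def)

lemma family_eqI:
  assumes "\<And>w. family_on_words \<gamma> w = family_on_words \<gamma>' w"
    and "\<And>xs us. length xs \<noteq> length us \<Longrightarrow> \<gamma> xs us = \<gamma>' xs us"
  shows "\<gamma> = \<gamma>'"
proof (intro ext)
  fix xs us
  show "\<gamma> xs us = \<gamma>' xs us"
    using assms(1)[of "zip xs us"] assms(2)[of xs us]
    by (cases "length xs = length us") (simp_all add: family_on_words_def)
qed

text \<open>
  In degree \<open>1\<close> the third component is a zero element of the module of families of degree \<open>0\<close>, and the
  coboundary of zero is zero, so degree \<open>1\<close> can be treated like the higher degrees.
\<close>

lemma cochain_iff:
  assumes "n \<ge> 1"
  shows "(\<alpha>, \<beta>, \<gamma>) \<in> mrRBA_cochains scaleA scaleM n \<longleftrightarrow>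
    \<alpha> \<in> Hom_tensor scaleA scaleA n \<and> \<beta> \<in> Hom_mixed scaleA scaleM n \<and>
    \<gamma> \<in> RB_cochains scaleA scaleM (n - 1) \<and> (n = 1 \<longrightarrow> \<gamma> = 0)"
  using assms RB_cochains_iff[OF A.module_axioms M.module_axioms, of 0 "n - 1"]
  by (auto simp: mrRBA_cochains_def multilinear_word_def family_on_words_def)

lemma delta_RB_zero: "delta_RB l r P n 0 = 0"
proof (rule family_eqI)
  have "family_on_words (0 :: 'x list \<Rightarrow> 'm list \<Rightarrow> 'a) = (\<lambda>_. 0)" by (simp add: family_on_words_def fun_eq_iff)
  then show "family_on_words (delta_RB l r P n 0) w = family_on_words 0 w" for w
    using RB.coboundary_zero[of n w] by (simp add: coboundary_family[symmetric])
qed (simp add: delta_RB_def)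

lemma delta_mrRBA_eq:
  assumes "n \<ge> 1" and "(\<alpha>, \<beta>, \<gamma>) \<in> mrRBA_cochains scaleA scaleM n"
  shows "delta_mrRBA l r P n (\<alpha>, \<beta>, \<gamma>) =
    (delta_Hoch n \<alpha>, delta_Hoch_mixed l r n \<alpha> \<beta>, delta_RB l r P (n - 1) \<gamma> + h_RB P n \<alpha> \<beta>)"
  using assms by (auto simp: delta_mrRBA_def cochain_iff delta_RB_zero)

lemma family_third_component:
  assumes "\<beta> \<in> Hom_mixed scaleA scaleM n"
  shows "family_on_words (delta_RB l r P k \<gamma> + h_RB P n \<alpha> \<beta>) w =
    RB.coboundary k (family_on_words \<gamma>) w
    + (if length w = n then alt_sign n (pullback (joint_cochain \<alpha> \<beta>) w) else 0)"
  unfolding coboundary_family family_h_RB[OF assms, symmetric] by (simp add: family_on_words_def)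

lemma mrRBA_scale_comb:
  "mrRBA_scale scaleA scaleM c (\<alpha>, \<beta>, \<gamma>) + (\<alpha>', \<beta>', \<gamma>') =
    (\<lambda>as. scaleA c (\<alpha> as) + \<alpha>' as, \<lambda>w. scaleM c (\<beta> w) + \<beta>' w, \<lambda>xs us. scaleA c (\<gamma> xs us) + \<gamma>' xs us)"
  by (simp add: mrRBA_scale_def fun_eq_iff)

lemma family_comb:
  "family_on_words (\<lambda>xs us. scaleA c (\<gamma> xs us) + \<gamma>' xs us) =
    (\<lambda>w. scaleA c (family_on_words \<gamma> w) + family_on_words \<gamma>' w)"
  by (simp add: family_on_words_def fun_eq_iff)

lemma cochain_comb:
  assumes "f \<in> mrRBA_cochains scaleA scaleM n" and "g \<in> mrRBA_cochains scaleA scaleM n"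
  shows "mrRBA_scale scaleA scaleM c f + g \<in> mrRBA_cochains scaleA scaleM n"
proof (cases "n = 0")
  case True
  then show ?thesis
    using assms by (simp add: mrRBA_cochains_def mrRBA_scale_def zero_prod_def zero_fun_def)
next
  case False
  obtain \<alpha> \<beta> \<gamma> \<alpha>' \<beta>' \<gamma>' where fg: "f = (\<alpha>, \<beta>, \<gamma>)" "g = (\<alpha>', \<beta>', \<gamma>')"
    by (metis prod_cases3)
  have "n \<ge> 1" using False by simp
  note C = assms[unfolded fg cochain_iff[OF this] RB_cochains_iff[OF A.module_axioms M.module_axioms]
      conj_assoc[symmetric] Hom_iff_joint]
  from C show ?thesis
    unfolding fg mrRBA_scale_comb cochain_iff[OF \<open>n \<ge> 1\<close>]
      RB_cochains_iff[OF A.module_axioms M.module_axioms] conj_assoc[symmetric] Hom_iff_joint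
      family_comb joint_cochain_comb
    by (auto intro!: Mix.multilinear_word_comb A.multilinear_word_comb simp: fun_eq_iff)
qed

lemma delta_closed:
  assumes n: "n \<ge> 1" and f: "f \<in> mrRBA_cochains scaleA scaleM n"
  shows "delta_mrRBA l r P n f \<in> mrRBA_cochains scaleA scaleM (Suc n)"
proof -
  obtain \<alpha> \<beta> \<gamma> where fe: "f = (\<alpha>, \<beta>, \<gamma>)" by (metis prod_cases3)
  from f have \<alpha>: "\<alpha> \<in> Hom_tensor scaleA scaleA n" and \<beta>: "\<beta> \<in> Hom_mixed scaleA scaleM n"
    and \<gamma>: "\<gamma> \<in> RB_cochains scaleA scaleM (n - 1)"
    by (auto simp: fe cochain_iff[OF n])
  have J: "multilinear_word (mixed_comb scaleA scaleM) (pair_scale scaleA scaleM) n (joint_cochain \<alpha> \<beta>)"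
    using \<alpha> \<beta> Hom_iff_joint by blast
  have "delta_Hoch n \<alpha> \<in> Hom_tensor scaleA scaleA (Suc n) \<and>
      delta_Hoch_mixed l r n \<alpha> \<beta> \<in> Hom_mixed scaleA scaleM (Suc n)"
    unfolding Hom_iff_joint coboundary_joint[OF \<beta>, symmetric]
    using Mix.multilinear_coboundary[OF J] by (simp add: delta_Hoch_def delta_Hoch_mixed_def)
  moreover have "delta_RB l r P (n - 1) \<gamma> + h_RB P n \<alpha> \<beta> \<in> RB_cochains scaleA scaleM n"
  proof -
    have "multilinear_word (indexed_comb scaleM) scaleA n
        (\<lambda>w. if length w = n then alt_sign n (pullback (joint_cochain \<alpha> \<beta>) w) else 0)"
      using multilinear_pullback[OF J] unfolding multilinear_word_def
      by (auto simp: alt_sign_def)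
    moreover have "multilinear_word (indexed_comb scaleM) scaleA n
        (RB.coboundary (n - 1) (family_on_words \<gamma>))"
      using RB.multilinear_coboundary[of "n - 1" "family_on_words \<gamma>"] \<gamma> n
      by (simp add: RB_cochains_iff[OF A.module_axioms M.module_axioms])
    ultimately have "multilinear_word (indexed_comb scaleM) scaleA n
        (family_on_words (delta_RB l r P (n - 1) \<gamma> + h_RB P n \<alpha> \<beta>))"
      using A.multilinear_word_comb[where c = 1] by (simp add: family_third_component[OF \<beta>, abs_def])
    then show ?thesis
      using n by (auto simp: RB_cochains_iff[OF A.module_axioms M.module_axioms] delta_RB_def h_RB_def)
  qed
  ultimately show ?thesis
    using n f by (simp add: fe delta_mrRBA_eq cochain_iff)
qed

lemma delta_comb:
  assumes f: "f \<in> mrRBA_cochains scaleA scaleM n" and g: "g \<in> mrRBA_cochains scaleA scaleM n"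
  shows "delta_mrRBA l r P n (mrRBA_scale scaleA scaleM c f + g) =
    mrRBA_scale scaleA scaleM c (delta_mrRBA l r P n f) + delta_mrRBA l r P n g"
proof (cases "n = 0")
  case True
  have "mrRBA_scale scaleA scaleM c 0 = 0"
    by (simp add: mrRBA_scale_def zero_prod_def zero_fun_def)
  then show ?thesis using True by (simp add: delta_mrRBA_def split: prod.splits)
next
  case False
  then have n: "n \<ge> 1" by simp
  obtain \<alpha> \<beta> \<gamma> \<alpha>' \<beta>' \<gamma>' where fg: "f = (\<alpha>, \<beta>, \<gamma>)" "g = (\<alpha>', \<beta>', \<gamma>')"
    by (metis prod_cases3)
  let ?\<alpha> = "\<lambda>as. scaleA c (\<alpha> as) + \<alpha>' as" and ?\<beta> = "\<lambda>w. scaleM c (\<beta> w) + \<beta>' w"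
    and ?\<gamma> = "\<lambda>xs us. scaleA c (\<gamma> xs us) + \<gamma>' xs us"
  have comb: "(?\<alpha>, ?\<beta>, ?\<gamma>) \<in> mrRBA_cochains scaleA scaleM n"
    using cochain_comb[OF f g, of c] by (simp add: fg mrRBA_scale_comb)
  have \<beta>: "\<beta> \<in> Hom_mixed scaleA scaleM n" "\<beta>' \<in> Hom_mixed scaleA scaleM n"
    "?\<beta> \<in> Hom_mixed scaleA scaleM n"
    using f g comb by (simp_all add: fg cochain_iff[OF n])
  have "joint_cochain (delta_Hoch n ?\<alpha>) (delta_Hoch_mixed l r n ?\<alpha> ?\<beta>) =
    joint_cochain (\<lambda>as. scaleA c (delta_Hoch n \<alpha> as) + delta_Hoch n \<alpha>' as)
      (\<lambda>w. scaleM c (delta_Hoch_mixed l r n \<alpha> \<beta> w) + delta_Hoch_mixed l r n \<alpha>' \<beta>' w)"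
    unfolding joint_cochain_comb \<beta>[THEN coboundary_joint, symmetric]
    by (rule ext) (rule Mix.coboundary_comb)
  note Hoch = joint_cochain_eqI[OF this]
  have "delta_RB l r P (n - 1) ?\<gamma> + h_RB P n ?\<alpha> ?\<beta> =
    (\<lambda>xs us. scaleA c ((delta_RB l r P (n - 1) \<gamma> + h_RB P n \<alpha> \<beta>) xs us)
      + (delta_RB l r P (n - 1) \<gamma>' + h_RB P n \<alpha>' \<beta>') xs us)"
  proof (rule family_eqI)
    have "alt_sign k (scaleA c x + y) = scaleA c (alt_sign k x) + alt_sign k y" for k x y
      by (simp add: alt_sign_def)
    then show "family_on_words (delta_RB l r P (n - 1) ?\<gamma> + h_RB P n ?\<alpha> ?\<beta>) w =
      family_on_words (\<lambda>xs us. scaleA c ((delta_RB l r P (n - 1) \<gamma> + h_RB P n \<alpha> \<beta>) xs us)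
      + (delta_RB l r P (n - 1) \<gamma>' + h_RB P n \<alpha>' \<beta>') xs us) w" for w
      unfolding family_comb \<beta>[THEN family_third_component] joint_cochain_comb RB.coboundary_comb
        pullback_comb
      by (simp add: A.scale_right_distrib add_ac)
  qed (auto simp: delta_RB_def h_RB_def)
  then show ?thesis
    using f g comb
    by (simp add: fg mrRBA_scale_comb delta_mrRBA_eq[OF n] Hoch)
qed

lemma zero_cochain: "(0 :: ('a, 'm, 'x) mrRBA_cochain) \<in> mrRBA_cochains scaleA scaleM n"
  by (simp add: mrRBA_cochains_def zero_prod_def Hom_tensor_iff[OF A.module_axioms A.module_axioms]
      Hom_mixed_iff[OF A.module_axioms M.module_axioms]
      RB_cochains_iff[OF A.module_axioms M.module_axioms] multilinear_word_def family_on_words_def)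

lemma delta_zero: "delta_mrRBA l r P n 0 = 0"
proof -
  have "mrRBA_scale scaleA scaleM 1 f = f" for f :: "('a, 'm, 'x) mrRBA_cochain"
    by (cases f) (simp add: mrRBA_scale_def)
  with delta_comb[OF zero_cochain zero_cochain, where n = n and c = 1] show ?thesis by simp
qed

text \<open>
  The first two components are the square of the Hochschild coboundary of the joint cochain. In the third one,
  the square on families vanishes, and the two remaining terms are the pullback of the coboundary of the
  joint cochain with the signs of degree \<open>n\<close> and \<open>n + 1\<close>.
\<close>

lemma delta_delta:
  assumes n: "n \<ge> 1" and f: "f \<in> mrRBA_cochains scaleA scaleM n"
  shows "delta_mrRBA l r P (Suc n) (delta_mrRBA l r P n f) = 0"
proof -
  obtain \<alpha> \<beta> \<gamma> where fe: "f = (\<alpha>, \<beta>, \<gamma>)" by (metis prod_cases3)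
  from f have \<alpha>: "\<alpha> \<in> Hom_tensor scaleA scaleA n" and \<beta>: "\<beta> \<in> Hom_mixed scaleA scaleM n"
    and \<gamma>: "\<gamma> \<in> RB_cochains scaleA scaleM (n - 1)"
    by (auto simp: fe cochain_iff[OF n])
  let ?J = "joint_cochain \<alpha> \<beta>"
  let ?\<alpha> = "delta_Hoch n \<alpha>" and ?\<beta> = "delta_Hoch_mixed l r n \<alpha> \<beta>"
    and ?\<gamma> = "delta_RB l r P (n - 1) \<gamma> + h_RB P n \<alpha> \<beta>"
  have J: "multilinear_word (mixed_comb scaleA scaleM) (pair_scale scaleA scaleM) n ?J"
    using \<alpha> \<beta> Hom_iff_joint by blast
  have \<gamma>_lin: "multilinear_word (indexed_comb scaleM) scaleA (n - 1) (family_on_words \<gamma>)"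
    using \<gamma> by (simp add: RB_cochains_iff[OF A.module_axioms M.module_axioms])
  have df: "delta_mrRBA l r P n f = (?\<alpha>, ?\<beta>, ?\<gamma>)"
    using f unfolding fe by (rule delta_mrRBA_eq[OF n])
  have closed: "(?\<alpha>, ?\<beta>, ?\<gamma>) \<in> mrRBA_cochains scaleA scaleM (Suc n)"
    using delta_closed[OF n f] by (simp add: df)
  then have d\<beta>: "?\<beta> \<in> Hom_mixed scaleA scaleM (Suc n)" by (simp add: cochain_iff)
  have dJ: "joint_cochain ?\<alpha> ?\<beta> = Mix.coboundary n ?J" by (simp add: coboundary_joint[OF \<beta>])
  have "joint_cochain (delta_Hoch (Suc n) ?\<alpha>) (delta_Hoch_mixed l r (Suc n) ?\<alpha> ?\<beta>) = joint_cochain 0 0"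
    unfolding coboundary_joint[OF d\<beta>, symmetric] dJ
    by (auto simp: Mix.coboundary_coboundary[OF J] joint_cochain_def zero_prod_def)
  note Hoch = joint_cochain_eqI[OF this]
  have "delta_RB l r P n ?\<gamma> + h_RB P (Suc n) ?\<alpha> ?\<beta> = 0"
  proof (rule family_eqI)
    fix w :: "('x \<times> 'm) list"
    have "RB.coboundary n (family_on_words ?\<gamma>) w
        = RB.coboundary n (\<lambda>v. RB.coboundary (n - 1) (family_on_words \<gamma>) v + alt_sign n (pullback ?J v)) w"
      by (rule RB.coboundary_cong) (simp add: family_third_component[OF \<beta>])
    also have "\<dots> = alt_sign n (RB.coboundary n (pullback ?J) w)"
      using RB.coboundary_coboundary[OF \<gamma>_lin, of w] n
      by (simp add: RB.coboundary_add RB.coboundary_alt_sign)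
    also have "\<dots> = (if length w = Suc n then alt_sign n (pullback (Mix.coboundary n ?J) w) else 0)"
      by (simp add: pullback_coboundary[OF J]) (simp add: RB.coboundary_def)
    finally show "family_on_words (delta_RB l r P n ?\<gamma> + h_RB P (Suc n) ?\<alpha> ?\<beta>) w = family_on_words 0 w"
      using family_third_component[OF d\<beta>, of n ?\<gamma> ?\<alpha> w]
      by (simp add: dJ alt_sign_Suc family_on_words_def)
  qed (auto simp: delta_RB_def h_RB_def)
  then show ?thesis
    unfolding df by (subst delta_mrRBA_eq[OF _ closed]) (simp_all add: Hoch zero_prod_def)
qed

lemma mrRBA_cochain_complex:
  "cochain_complex (mrRBA_scale scaleA scaleM :: 'k \<Rightarrow> ('a, 'm, 'x) mrRBA_cochain \<Rightarrow> _)
    (mrRBA_cochains scaleA scaleM) (delta_mrRBA l r P)"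
proof -
  let ?s = "mrRBA_scale scaleA scaleM :: 'k \<Rightarrow> ('a, 'm, 'x) mrRBA_cochain \<Rightarrow> _"
    and ?C = "mrRBA_cochains scaleA scaleM :: nat \<Rightarrow> ('a, 'm, 'x) mrRBA_cochain set"
  interpret module ?s
    by unfold_locales
      (auto simp: mrRBA_scale_def fun_eq_iff A.scale_right_distrib A.scale_left_distrib
        M.scale_right_distrib M.scale_left_distrib)
  note zero = zero_cochain
  have C0: "f \<in> ?C 0 \<longleftrightarrow> f = 0" and d0: "delta_mrRBA l r P 0 f = 0" for f
    by (simp_all add: mrRBA_cochains_def delta_mrRBA_def split: prod.splits)
  show ?thesis
  proof unfold_locales
    show "subspace (?C n)" for n
      unfolding subspace_def
      using zero cochain_comb[of _ n _ 1] cochain_comb[OF _ zero, of _ n]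
      by (metis add.right_neutral scale_one)
    fix n f assume f: "f \<in> ?C n"
    show "delta_mrRBA l r P n f \<in> ?C (Suc n)"
      using delta_closed[OF _ f] zero d0 by (cases "n = 0") auto
    show "delta_mrRBA l r P (Suc n) (delta_mrRBA l r P n f) = 0"
      using delta_delta[OF _ f] by (cases "n = 0") (auto simp: d0 delta_zero)
    show "delta_mrRBA l r P n (?s c f) = ?s c (delta_mrRBA l r P n f)" for c
      using delta_comb[OF f zero, of c] by (simp add: delta_zero)
    show "delta_mrRBA l r P n (f + g) = delta_mrRBA l r P n f + delta_mrRBA l r P n g"
      if "g \<in> ?C n" for g
      using delta_comb[OF f that, of 1] by simp
  qed
qed

end

theorem theorem4p5:
  fixes scaleA :: "'k::comm_ring_1 \<Rightarrow> 'a::ring \<Rightarrow> 'a"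
    and scaleM :: "'k \<Rightarrow> 'm::ab_group_add \<Rightarrow> 'm"
    and l :: "'a \<Rightarrow> 'm \<Rightarrow> 'm" and r :: "'m \<Rightarrow> 'a \<Rightarrow> 'm"
    and P :: "'x \<Rightarrow> 'm \<Rightarrow> 'a"
  assumes "CHAR('k) \<noteq> 2"
    and "matching_rel_RB_algebra scaleA scaleM l r P"
  shows "cochain_complex
           (mrRBA_scale scaleA scaleM
              :: 'k \<Rightarrow> ('a, 'm, 'x) mrRBA_cochain \<Rightarrow> ('a, 'm, 'x) mrRBA_cochain)
           (mrRBA_cochains scaleA scaleM)
           (delta_mrRBA l r P)"
  using assms(2) by (rule matching_rel_RB_algebra.mrRBA_cochain_complex)

end
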